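(* Let $\mathcal{S} \subseteq M_n$ be a quantum graph and $k\in\mathbb{N}$. Then $\mathcal{S}$ is $k$-connected if and only if the classical graph $C_v(\mathcal{S})$ is $k$-connected for every orthonormal basis $v=(|v_i\rangle)_{i=1}^n$ of $\mathbb{C}^n$.
   Context: A quantum graph on $M_n$ is a linear subspace $\mathcal{S}\subseteq M_n$ closed under adjoints and containing $I_n$. A quantum graph $\mathcal{T}\subseteq M_N$ is connected if $\mathcal{T}^m=M_N$ for some $m\in\mathbb{N}$ (powers are spans of products); otherwise disconnected. For a projection $P\in M_n$, $(I_n-P)\mathcal{S}(I_n-P)$ is regarded as a quantum graph in $(I_n-P)M_n(I_n-P)\cong M_{n-\operatorname{rank}(P)}$. A projection $P$ is a separator of $\mathcal{S}$ if $(I_n-P)\mathcal{S}(I_n-P)$ is either disconnected or $1$-dimensional; $\mathcal{S}$ is $k$-connected if every separator has rank at least $k$. For an ordered orthonormal basis $v$, $C_v(\mathcal{S})$ is the classical graph on $\{1,\dots,n\}$ with distinct $i,j$ adjacent exactly when $\langle v_i|A|v_j\rangle\neq 0$ for some $A\in\mathcal{S}$. A classical graph is $k$-connected if every set of vertices whose removal leaves a disconnected graph or a single vertex has at least $k$ elements. *)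

theory Defs
  imports "HOL-Analysis.Analysis"
begin

type_synonym 'n cmat = "complex^'n^'n"

definition mat_adj :: "'n::finite cmat \<Rightarrow> 'n cmat" where
  "mat_adj A = (\<chi> i j. cnj (A$j$i))"

definition cscale :: "complex \<Rightarrow> 'n::finite cmat \<Rightarrow> 'n cmat" where
  "cscale c A = (\<chi> i j. c * A$i$j)"

definition csubspace :: "'n::finite cmat set \<Rightarrow> bool" where
  "csubspace S \<longleftrightarrow> 0 \<in> S \<and> (\<forall>A\<in>S. \<forall>B\<in>S. A + B \<in> S) \<and> (\<forall>c. \<forall>A\<in>S. cscale c A \<in> S)"

definition cspan :: "'n::finite cmat set \<Rightarrow> 'n cmat set" where
  "cspan X = \<Inter>{T. csubspace T \<and> X \<subseteq> T}"

definition quantum_graph :: "'n::finite cmat set \<Rightarrow> bool" where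
  "quantum_graph S \<longleftrightarrow> csubspace S \<and> (\<forall>A\<in>S. mat_adj A \<in> S) \<and> mat 1 \<in> S"

definition set_prod :: "'n::finite cmat set \<Rightarrow> 'n cmat set \<Rightarrow> 'n cmat set" where
  "set_prod X Y = {A ** B | A B. A \<in> X \<and> B \<in> Y}"

text \<open>Powers of a subspace: T^1 = T, T^(m+1) = span of products of T^m and T.
  Only exponents m >= 1 are used.\<close>
fun qpow :: "'n::finite cmat set \<Rightarrow> nat \<Rightarrow> 'n cmat set" where
  "qpow T 0 = {0}"
| "qpow T (Suc 0) = T"
| "qpow T (Suc (Suc m)) = cspan (set_prod (qpow T (Suc m)) T)"

text \<open>The corner algebra Q M_n Q, identified with M_(rank Q).\<close>
definition corner :: "'n::finite cmat \<Rightarrow> 'n cmat set" where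
  "corner Q = {Q ** A ** Q | A. True}"

text \<open>Connectedness of a quantum graph T inside the corner Q M_n Q.\<close>
definition qconnected_in :: "'n::finite cmat \<Rightarrow> 'n cmat set \<Rightarrow> bool" where
  "qconnected_in Q T \<longleftrightarrow> (\<exists>m\<ge>1. qpow T m = corner Q)"

definition one_dim :: "'n::finite cmat set \<Rightarrow> bool" where
  "one_dim T \<longleftrightarrow> (\<exists>A. A \<noteq> 0 \<and> T = {cscale c A | c. True})"

definition is_projection :: "'n::finite cmat \<Rightarrow> bool" where
  "is_projection P \<longleftrightarrow> P ** P = P \<and> mat_adj P = P"

definition compression :: "'n::finite cmat \<Rightarrow> 'n cmat set \<Rightarrow> 'n cmat set" where
  "compression P S = {(mat 1 - P) ** A ** (mat 1 - P) | A. A \<in> S}"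

definition q_separator :: "'n::finite cmat set \<Rightarrow> 'n cmat \<Rightarrow> bool" where
  "q_separator S P \<longleftrightarrow> is_projection P \<and>
     (\<not> qconnected_in (mat 1 - P) (compression P S) \<or> one_dim (compression P S))"

definition q_k_connected :: "'n::finite cmat set \<Rightarrow> nat \<Rightarrow> bool" where
  "q_k_connected S k \<longleftrightarrow> (\<forall>P. q_separator S P \<longrightarrow> rank P \<ge> k)"

definition cinner :: "complex^'n::finite \<Rightarrow> complex^'n \<Rightarrow> complex" where
  "cinner x y = (\<Sum>i\<in>UNIV. cnj (x$i) * y$i)"

definition orthonormal_basis :: "('n::finite \<Rightarrow> complex^'n) \<Rightarrow> bool" where
  "orthonormal_basis v \<longleftrightarrow> (\<forall>i j. cinner (v i) (v j) = (if i = j then 1 else 0))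
     \<and> vec.span (range v) = UNIV"

text \<open>Classical graph C_v(S) on vertex type 'n.\<close>
definition Cv :: "('n::finite \<Rightarrow> complex^'n) \<Rightarrow> 'n cmat set \<Rightarrow> 'n \<Rightarrow> 'n \<Rightarrow> bool" where
  "Cv v S i j \<longleftrightarrow> i \<noteq> j \<and> (\<exists>A\<in>S. cinner (v i) (A *v v j) \<noteq> 0)"

definition graph_connected_on :: "('a \<Rightarrow> 'a \<Rightarrow> bool) \<Rightarrow> 'a set \<Rightarrow> bool" where
  "graph_connected_on E V \<longleftrightarrow>
     (\<forall>x\<in>V. \<forall>y\<in>V. (x, y) \<in> {(a, b). a \<in> V \<and> b \<in> V \<and> E a b}\<^sup>*)"

definition c_separator :: "('a::finite \<Rightarrow> 'a \<Rightarrow> bool) \<Rightarrow> 'a set \<Rightarrow> bool" where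
  "c_separator E X \<longleftrightarrow> \<not> graph_connected_on E (UNIV - X) \<or> card (UNIV - X) = 1"

definition c_k_connected :: "('a::finite \<Rightarrow> 'a \<Rightarrow> bool) \<Rightarrow> nat \<Rightarrow> bool" where
  "c_k_connected E k \<longleftrightarrow> (\<forall>X. c_separator E X \<longrightarrow> card X \<ge> k)"

end

theory Submission
  imports Defs "HOL-Computational_Algebra.Fundamental_Theorem_Algebra"
begin

text \<open>A classical separator \<open>X\<close> for a basis \<open>v\<close> gives the coordinate projection
  \<open>P\<^sub>X\<close> of rank \<open>|X|\<close>, and inside \<open>-X\<close> the vertex sets that no edge of \<open>C\<^sub>v(S)\<close>
  leaves are exactly those whose coordinate projections commute with the compression of \<open>S\<close>.
  On the quantum side, a quantum graph \<open>T\<close> in a corner \<open>Q M\<^sub>n Q\<close> is connected iff no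
  projection strictly between \<open>0\<close> and \<open>Q\<close> commutes with \<open>T\<close>. Such a projection commutes
  with all powers of \<open>T\<close>; conversely the powers stabilise at a unital *-algebra which, if
  irreducible, acts transitively on the range of \<open>Q\<close>, contains a rank-one operator (an
  element of minimal rank, found with the help of an eigenvector) and hence the whole corner.
  Finally, a quantum separator and a reducing projection of its compression are diagonal in a
  common orthonormal basis, which turns them into a classical separator of the same size.\<close>

section \<open>Matrix algebra over the complex numbers\<close>

text \<open>The rank-one operator \<open>|u\<rangle>\<langle>w|\<close>.\<close>
definition outer_prod :: "complex^'n::finite \<Rightarrow> complex^'n \<Rightarrow> 'n cmat" where
  "outer_prod u w = (\<chi> i j. u$i * cnj (w$j))"

lemma matrix_mul_add_rdistrib: "((A::'n::finite cmat) + B) ** C = A ** C + B ** C"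
  by (simp add: matrix_matrix_mult_def vec_eq_iff algebra_simps sum.distrib)

lemma matrix_mul_diff_rdistrib: "((A::'n::finite cmat) - B) ** C = A ** C - B ** C"
  by (simp add: matrix_matrix_mult_def vec_eq_iff algebra_simps sum_subtractf)

lemma matrix_mul_diff_ldistrib: "(A::'n::finite cmat) ** (B - C) = A ** B - A ** C"
  by (simp add: matrix_matrix_mult_def vec_eq_iff algebra_simps sum_subtractf)

lemma matrix_mul_sum_right: "sum (f::_ \<Rightarrow> 'n::finite cmat) I ** (A::'n cmat) = (\<Sum>i\<in>I. f i ** A)"
  by (induct I rule: infinite_finite_induct) (auto simp: matrix_mul_add_rdistrib)

lemma matrix_vector_mult_sum_left: "sum f I *v (x::complex^'n::finite) = (\<Sum>i\<in>I. f i *v x)"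
  by (induct I rule: infinite_finite_induct) (auto simp: matrix_vector_mult_add_rdistrib)

lemma cinner_add_right: "cinner x (y + z) = cinner x y + cinner x z"
  by (simp add: cinner_def algebra_simps sum.distrib)

lemma cinner_diff_right: "cinner x (y - z) = cinner x y - cinner x z"
  by (simp add: cinner_def algebra_simps sum_subtractf)

lemma cinner_scale_right: "cinner x (c *s y) = c * cinner x y"
  by (simp add: cinner_def sum_distrib_left algebra_simps)

lemma cinner_scale_left: "cinner (c *s x) y = cnj c * cinner x y"
  by (simp add: cinner_def sum_distrib_left algebra_simps)

lemma cinner_zero_left [simp]: "cinner 0 x = 0"
  by (simp add: cinner_def)

lemma cinner_zero_right [simp]: "cinner x 0 = 0"
  by (simp add: cinner_def)

lemma cinner_sum_right: "cinner x (sum f I) = (\<Sum>i\<in>I. cinner x (f i))"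
  by (induct I rule: infinite_finite_induct) (auto simp: cinner_add_right)

lemma cinner_commute: "cinner y x = cnj (cinner x y)"
  by (simp add: cinner_def mult.commute)

lemma cinner_self: "cinner x x = of_real (\<Sum>i\<in>UNIV. (cmod (x$i))^2)"
  unfolding cinner_def of_real_sum
  by (rule sum.cong) (simp_all add: complex_norm_square mult.commute del: of_real_power)

lemma cinner_self_eq_0 [simp]: "cinner x x = 0 \<longleftrightarrow> x = 0"
proof -
  have "cinner x x = 0 \<longleftrightarrow> (\<Sum>i\<in>UNIV. (cmod (x$i))^2) = 0"
    unfolding cinner_self of_real_eq_0_iff ..
  also have "\<dots> \<longleftrightarrow> (\<forall>i. (cmod (x$i))^2 = 0)"
    by (subst sum_nonneg_eq_0_iff) auto
  also have "\<dots> \<longleftrightarrow> x = 0" by (simp add: vec_eq_iff)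
  finally show ?thesis .
qed

lemma cinner_matrix_vector_mult: "cinner x (A *v y) = cinner (mat_adj A *v x) y"
  unfolding cinner_def mat_adj_def matrix_vector_mult_def
  by (simp add: sum_distrib_left sum_distrib_right mult.assoc mult.left_commute) (rule sum.swap)

lemma mat_adj_mult: "mat_adj (A ** B) = mat_adj B ** mat_adj (A::'n::finite cmat)"
  by (simp add: mat_adj_def matrix_matrix_mult_def vec_eq_iff mult.commute)

lemma mat_adj_adj [simp]: "mat_adj (mat_adj A) = A"
  by (simp add: mat_adj_def vec_eq_iff)

lemma mat_adj_add: "mat_adj (A + B) = mat_adj A + mat_adj B"
  by (simp add: mat_adj_def vec_eq_iff)

lemma mat_adj_diff: "mat_adj (A - B) = mat_adj A - mat_adj B"
  by (simp add: mat_adj_def vec_eq_iff)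

lemma mat_adj_0 [simp]: "mat_adj 0 = 0"
  by (simp add: mat_adj_def vec_eq_iff)

lemma mat_adj_1 [simp]: "mat_adj (mat 1) = mat 1"
  by (simp add: mat_adj_def vec_eq_iff mat_def)

lemma mat_adj_cscale: "mat_adj (cscale c A) = cscale (cnj c) (mat_adj A)"
  by (simp add: mat_adj_def cscale_def vec_eq_iff)

lemma mat_adj_sum: "mat_adj (sum f I) = (\<Sum>i\<in>I. mat_adj (f i))"
  by (induct I rule: infinite_finite_induct) (auto simp: mat_adj_add)

lemma matrix_mul_cscale_left: "cscale c A ** B = cscale c (A ** B)"
  by (simp add: cscale_def matrix_matrix_mult_def vec_eq_iff sum_distrib_left mult_ac)

lemma matrix_mul_cscale_right: "A ** cscale c B = cscale c (A ** B)"
  by (simp add: cscale_def matrix_matrix_mult_def vec_eq_iff sum_distrib_left mult_ac)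

lemma matrix_vector_mult_cscale: "cscale c A *v x = c *s (A *v x)"
  by (simp add: cscale_def matrix_vector_mult_def vec_eq_iff sum_distrib_left mult_ac)

lemma cscale_cscale: "cscale c (cscale d A) = cscale (c * d) A"
  by (simp add: cscale_def vec_eq_iff)

lemma cscale_eq_0_iff: "cscale c A = 0 \<longleftrightarrow> c = 0 \<or> A = 0"
  by (auto simp: cscale_def vec_eq_iff)

lemma cscale_1 [simp]: "cscale 1 A = A"
  by (simp add: cscale_def vec_eq_iff)

lemma outer_prod_mult_vec: "outer_prod u w *v x = cinner w x *s u"
  by (simp add: outer_prod_def matrix_vector_mult_def cinner_def vec_eq_iff sum_distrib_left
      sum_distrib_right mult_ac)

lemma matrix_mul_outer_prod: "A ** outer_prod u w = outer_prod (A *v u) w"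
  by (simp add: outer_prod_def matrix_vector_mult_def matrix_matrix_mult_def vec_eq_iff
      sum_distrib_right sum_distrib_left mult_ac)

lemma outer_prod_matrix_mul: "outer_prod u w ** A = outer_prod u (mat_adj A *v w)"
  by (simp add: outer_prod_def matrix_vector_mult_def matrix_matrix_mult_def vec_eq_iff mat_adj_def
      sum_distrib_left mult_ac)

lemma mat_adj_outer_prod: "mat_adj (outer_prod u w) = outer_prod w u"
  by (simp add: outer_prod_def mat_adj_def vec_eq_iff)

lemma outer_prod_scale_right: "outer_prod u (c *s w) = cscale (cnj c) (outer_prod u w)"
  by (simp add: outer_prod_def cscale_def vec_eq_iff mult_ac)

lemma outer_prod_eq_0_iff: "outer_prod u w = 0 \<longleftrightarrow> u = 0 \<or> w = 0"
  by (auto simp: outer_prod_def vec_eq_iff)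

lemma outer_prod_0_left [simp]: "outer_prod 0 w = 0"
  and outer_prod_0_right [simp]: "outer_prod u 0 = 0"
  by (simp_all add: outer_prod_eq_0_iff)

lemma matrix_eq_sum_outer_prod_columns:
  "(M::'n::finite cmat) = (\<Sum>j\<in>UNIV. outer_prod (M *v axis j 1) (axis j 1))"
proof -
  have "(\<Sum>j\<in>UNIV. outer_prod (M *v axis j 1) (axis j 1)) $ i $ k =
      (\<Sum>j\<in>UNIV. (M *v axis j 1) $ i * cnj (axis j 1 $ k))" for i k
    by (simp add: outer_prod_def)
  also have "\<dots> i k = M $ i $ k" for i k
    by (simp add: axis_def matrix_vector_mult_def if_distrib if_distribR cong: if_cong)
  finally show ?thesis by (simp add: vec_eq_iff)
qed

section \<open>Subspaces of matrices and corners\<close>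

lemma csubspace_0: "csubspace S \<Longrightarrow> 0 \<in> S"
  by (simp add: csubspace_def)

lemma csubspace_add: "csubspace S \<Longrightarrow> A \<in> S \<Longrightarrow> B \<in> S \<Longrightarrow> A + B \<in> S"
  by (simp add: csubspace_def)

lemma csubspace_cscale: "csubspace S \<Longrightarrow> A \<in> S \<Longrightarrow> cscale c A \<in> S"
  by (simp add: csubspace_def)

lemma csubspace_diff:
  assumes "csubspace S" "A \<in> S" "B \<in> S"
  shows "A - B \<in> S"
proof -
  have "A + cscale (-1) B \<in> S" using assms by (simp add: csubspace_add csubspace_cscale)
  moreover have "A + cscale (-1) B = A - B" by (simp add: cscale_def vec_eq_iff)
  ultimately show ?thesis by simp
qed

lemma csubspace_sum: "csubspace S \<Longrightarrow> (\<And>i. i \<in> I \<Longrightarrow> f i \<in> S) \<Longrightarrow> sum f I \<in> S"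
  by (induct I rule: infinite_finite_induct) (auto simp: csubspace_0 csubspace_add)

lemma csubspace_cspan: "csubspace (cspan X)"
  unfolding cspan_def csubspace_def by auto

lemma cspan_superset: "X \<subseteq> cspan X"
  unfolding cspan_def by auto

lemma cspan_minimal: "csubspace T \<Longrightarrow> X \<subseteq> T \<Longrightarrow> cspan X \<subseteq> T"
  unfolding cspan_def by auto

lemma csubspace_imp_subspace:
  fixes S :: "'n::finite cmat set"
  assumes "csubspace S"
  shows "subspace S"
proof -
  have "r *\<^sub>R A = cscale (of_real r) A" for r and A :: "'n cmat"
    by (simp add: cscale_def vec_eq_iff flip: scaleR_conv_of_real)
  then show ?thesis
    using assms unfolding subspace_def by (auto simp: csubspace_0 csubspace_add csubspace_cscale)
qed

lemma csubspace_preimage_left_mult: "csubspace S \<Longrightarrow> csubspace {Y. X ** Y \<in> S}"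
  unfolding csubspace_def by (auto simp: matrix_add_ldistrib matrix_mul_cscale_right)

lemma csubspace_preimage_mat_adj: "csubspace S \<Longrightarrow> csubspace {Y. mat_adj Y \<in> S}"
  unfolding csubspace_def by (auto simp: mat_adj_add mat_adj_cscale)

lemma csubspace_commutant: "csubspace {N. N ** Q = Q ** (N::'n::finite cmat)}"
  unfolding csubspace_def
  by (auto simp: matrix_mul_add_rdistrib matrix_add_ldistrib matrix_mul_cscale_left
      matrix_mul_cscale_right)

lemma corner_iff:
  assumes "Q ** Q = Q"
  shows "M \<in> corner Q \<longleftrightarrow> Q ** M = M \<and> M ** Q = M"
proof
  assume "M \<in> corner Q"
  then obtain A where "M = Q ** A ** Q" by (auto simp: corner_def)
  moreover have "Q ** (Q ** A ** Q) = (Q ** Q) ** A ** Q" by (simp add: matrix_mul_assoc)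
  moreover have "(Q ** A ** Q) ** Q = (Q ** A) ** (Q ** Q)" by (simp add: matrix_mul_assoc)
  ultimately show "Q ** M = M \<and> M ** Q = M" using assms by simp
next
  assume "Q ** M = M \<and> M ** Q = M"
  then have "M = Q ** M ** Q" by simp
  then show "M \<in> corner Q" unfolding corner_def by blast
qed

lemma csubspace_corner: "csubspace (corner Q)"
  unfolding csubspace_def corner_def
proof (intro conjI allI ballI)
  show "0 \<in> {Q ** A ** Q |A. True}" by (rule CollectI, rule exI[of _ 0]) simp
  fix A B assume "A \<in> {Q ** A ** Q |A. True}" "B \<in> {Q ** A ** Q |A. True}"
  then obtain A' B' where "A = Q ** A' ** Q" "B = Q ** B' ** Q" by auto
  then have "A + B = Q ** (A' + B') ** Q" by (simp add: matrix_add_ldistrib matrix_mul_add_rdistrib)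
  then show "A + B \<in> {Q ** A ** Q |A. True}" by blast
next
  fix c A assume "A \<in> {Q ** A ** Q |A. True}"
  then obtain A' where "A = Q ** A' ** Q" by auto
  then have "cscale c A = Q ** (cscale c A') ** Q"
    by (simp add: matrix_mul_cscale_left matrix_mul_cscale_right)
  then show "cscale c A \<in> {Q ** A ** Q |A. True}" by blast
qed

lemma corner_mult_closed:
  assumes "Q ** Q = Q" "M \<in> corner Q" "N \<in> corner Q"
  shows "M ** N \<in> corner Q"
proof -
  have "Q ** (M ** N) = (Q ** M) ** N" "(M ** N) ** Q = M ** (N ** Q)"
    by (simp_all add: matrix_mul_assoc)
  then show ?thesis using assms by (simp add: corner_iff)
qed

lemma corner_rank_one:
  assumes u: "cinner u u = 1"
  shows "corner (outer_prod u u) = {cscale c (outer_prod u u) | c. True}"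
proof -
  let ?Q = "outer_prod u u"
  have idem: "?Q ** ?Q = ?Q" using u by (simp add: matrix_mul_outer_prod outer_prod_mult_vec)
  show ?thesis
  proof
    show "corner ?Q \<subseteq> {cscale c ?Q | c. True}"
    proof
      fix M assume "M \<in> corner ?Q"
      then have "M = ?Q ** M ** ?Q" using corner_iff[OF idem] by simp
      also have "\<dots> = cscale (cnj (cinner u (mat_adj M *v u))) ?Q"
        by (simp add: outer_prod_matrix_mul mat_adj_outer_prod outer_prod_mult_vec
            outer_prod_scale_right mat_adj_mult)
      finally show "M \<in> {cscale c ?Q | c. True}" by blast
    qed
    show "{cscale c ?Q | c. True} \<subseteq> corner ?Q"
      using csubspace_cscale[OF csubspace_corner] corner_iff[OF idem] idem by auto
  qed
qed

section \<open>Orthonormal sets and projections\<close>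

definition orthonormal_set :: "(complex^'n::finite) set \<Rightarrow> bool" where
  "orthonormal_set B \<longleftrightarrow> (\<forall>x\<in>B. \<forall>y\<in>B. cinner x y = (if x = y then 1 else 0))"

lemma orthonormal_set_nonzero: "orthonormal_set B \<Longrightarrow> x \<in> B \<Longrightarrow> x \<noteq> 0"
  unfolding orthonormal_set_def by force

lemma orthonormal_set_independent:
  assumes "finite B" "orthonormal_set B"
  shows "vec.independent B"
proof
  assume "vec.dependent B"
  then obtain u w where u: "(\<Sum>v\<in>B. u v *s v) = 0" and w: "w \<in> B" "u w \<noteq> 0"
    using vec.dependent_finite[OF assms(1)] by blast
  have "cinner w (\<Sum>v\<in>B. u v *s v) = (\<Sum>v\<in>B. u v * (if w = v then 1 else 0))"
    using assms w by (simp add: cinner_sum_right cinner_scale_right orthonormal_set_def)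
  also have "\<dots> = u w" using assms w by (simp add: if_distrib if_distribR cong: if_cong)
  finally show False using u w by simp
qed

lemma orthonormal_set_Un:
  assumes A: "orthonormal_set A" and B: "orthonormal_set B"
    and AB: "\<And>a b. a \<in> A \<Longrightarrow> b \<in> B \<Longrightarrow> cinner a b = 0"
  shows "orthonormal_set (A \<union> B)"
proof -
  have "cinner a b = 0 \<and> cinner b a = 0 \<and> a \<noteq> b" if "a \<in> A" "b \<in> B" for a b
    using AB[OF that] orthonormal_set_nonzero[OF A that(1)] cinner_commute[of a b] by auto
  then show ?thesis using A B unfolding orthonormal_set_def by (auto simp del: cinner_self_eq_0)
qed

lemma normalize_vector:
  assumes "x \<noteq> 0"
  shows "\<exists>c. cinner (c *s x) (c *s x) = 1"
proof -
  define r where "r = (\<Sum>i\<in>UNIV. (cmod (x$i))^2)"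
  have "r \<noteq> 0" using assms by (metis cinner_self cinner_self_eq_0 of_real_0 r_def)
  then have r: "r > 0" unfolding r_def by (simp add: sum_nonneg order_le_neq_trans)
  define t where "t = 1 / sqrt r"
  have "cinner (complex_of_real t *s x) (complex_of_real t *s x) = complex_of_real (t * (t * r))"
    unfolding cinner_scale_left cinner_scale_right cinner_self[of x] r_def[symmetric] by simp
  also have "t * (t * r) = 1"
    using r unfolding t_def by (simp add: field_simps flip: power2_eq_square)
  finally show ?thesis by auto
qed

lemma span_insert_orthogonal_complement:
  assumes W: "vec.subspace W" and w: "w \<in> W" "cinner w w = 1"
  shows "vec.span (insert w {x\<in>W. cinner w x = 0}) = W"
proof
  show "vec.span (insert w {x\<in>W. cinner w x = 0}) \<subseteq> W"
    using W w by (intro vec.span_minimal) auto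
  show "W \<subseteq> vec.span (insert w {x\<in>W. cinner w x = 0})"
  proof
    fix x assume "x \<in> W"
    then have "x - cinner w x *s w \<in> {x\<in>W. cinner w x = 0}"
      using w W by (auto simp: cinner_diff_right cinner_scale_right
          intro!: vec.subspace_diff vec.subspace_scale)
    then show "x \<in> vec.span (insert w {x\<in>W. cinner w x = 0})"
      unfolding vec.span_insert by (blast intro: vec.span_base)
  qed
qed

lemma subspace_has_orthonormal_basis:
  "vec.subspace W \<Longrightarrow> \<exists>B. finite B \<and> B \<subseteq> W \<and> orthonormal_set B \<and> vec.span B = W"
proof (induct "vec.dim W" arbitrary: W rule: less_induct)
  case less
  show ?case
  proof (cases "W \<subseteq> {0}")
    case True
    then have "W = {0}" using less(2) vec.subspace_0 by blast
    then show ?thesis by (intro exI[of _ "{}"]) (auto simp: orthonormal_set_def)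
  next
    case False
    then obtain w0 where w0: "w0 \<in> W" "w0 \<noteq> 0" by blast
    then obtain c where c: "cinner (c *s w0) (c *s w0) = 1" using normalize_vector by blast
    define w where "w = c *s w0"
    have w1: "cinner w w = 1" using c by (simp add: w_def)
    have wW: "w \<in> W" unfolding w_def using less(2) w0(1) by (rule vec.subspace_scale)
    define W' where "W' = {x\<in>W. cinner w x = 0}"
    have W': "vec.subspace W'"
      using less(2) unfolding W'_def vec.subspace_def
      by (auto simp: cinner_add_right cinner_scale_right)
    have "w \<notin> W'" using w1 by (simp add: W'_def)
    then have psub: "W' \<subset> W" using wW unfolding W'_def by blast
    have span_eq: "vec.span W' = W'" "vec.span W = W"
      using W' less(2) by (simp_all only: vec.span_eq_iff)
    have "vec.span W' \<subset> vec.span W" unfolding span_eq by (fact psub)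
    then have "vec.dim W' < vec.dim W" by (rule vec.dim_psubset)
    from less(1)[OF this W'] obtain B' where
      B': "finite B'" "B' \<subseteq> W'" "orthonormal_set B'" "vec.span B' = W'" by blast
    define B where "B = {w} \<union> B'"
    have w_ortho: "orthonormal_set {w}" using w1 by (simp add: orthonormal_set_def)
    have w_perp: "cinner w b = 0" if "b \<in> B'" for b using that B'(2) by (auto simp: W'_def)
    have ortho: "orthonormal_set B"
      unfolding B_def by (rule orthonormal_set_Un[OF w_ortho B'(3)]) (simp add: w_perp)
    have "vec.span B = vec.span (insert w W')"
      unfolding B_def Un_insert_left sup_bot.left_neutral vec.span_insert B'(4) span_eq(1) ..
    then have span: "vec.span B = W"
      unfolding W'_def using span_insert_orthogonal_complement[OF less(2) wW w1] by simp
    have "finite B" "B \<subseteq> W" using B' wW by (auto simp: B_def W'_def)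
    with ortho span show ?thesis by blast
  qed
qed

lemma projection_onto_subspace_exists:
  assumes "vec.subspace V"
  shows "\<exists>E::'n::finite cmat. is_projection E \<and> (\<forall>x. E *v x \<in> V) \<and> (\<forall>x\<in>V. E *v x = x)"
proof -
  obtain B where B: "finite B" "orthonormal_set B" "vec.span B = V"
    using subspace_has_orthonormal_basis[OF assms] by blast
  define E where "E = (\<Sum>b\<in>B. outer_prod b b)"
  have E_apply: "E *v x = (\<Sum>b\<in>B. cinner b x *s b)" for x
    by (simp add: E_def matrix_vector_mult_sum_left outer_prod_mult_vec)
  have range: "E *v x \<in> V" for x
    unfolding E_apply B(3)[symmetric] by (intro vec.span_sum vec.span_scale vec.span_base)
  have E_fix: "E *v x = x" if "x \<in> V" for x
  proof -
    have "(E - mat 1) *v x = 0"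
    proof (rule vec.linear_eq_0_on_span[OF matrix_vector_mul_linear_gen])
      show "x \<in> vec.span B" using that B(3) by simp
      fix b assume b: "b \<in> B"
      have "E *v b = (\<Sum>b'\<in>B. (if b' = b then 1 else 0) *s b')"
        unfolding E_apply using B(2) b by (intro sum.cong) (auto simp: orthonormal_set_def)
      also have "\<dots> = b" using b B(1) by (simp add: if_distrib if_distribR cong: if_cong)
      finally show "(E - mat 1) *v b = 0" by (simp add: matrix_vector_mult_diff_rdistrib)
    qed
    then show ?thesis by (simp add: matrix_vector_mult_diff_rdistrib)
  qed
  have "E ** E = E"
    unfolding matrix_eq by (simp add: matrix_vector_mul_assoc[symmetric] E_fix range)
  moreover have "mat_adj E = E" by (simp add: E_def mat_adj_sum mat_adj_outer_prod)
  ultimately show ?thesis using range E_fix by (auto simp: is_projection_def)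
qed

lemma projection_adjoint_cinner: "is_projection P \<Longrightarrow> cinner x (P *v y) = cinner (P *v x) y"
  by (simp add: cinner_matrix_vector_mult is_projection_def)

lemma is_projection_0: "is_projection 0"
  by (simp add: is_projection_def)

lemma is_projection_complement: "is_projection P \<Longrightarrow> is_projection (mat 1 - P)"
  unfolding is_projection_def by (simp add: matrix_mul_diff_ldistrib matrix_mul_diff_rdistrib mat_adj_diff)

lemma projection_mult_eq_0_commute:
  "is_projection P \<Longrightarrow> is_projection Q \<Longrightarrow> P ** Q = 0 \<Longrightarrow> Q ** P = 0"
  by (metis mat_adj_mult mat_adj_0 is_projection_def)

lemma projection_fixed_vectors_orthogonal:
  assumes "is_projection P" "P ** Q = 0" "P *v x = x" "Q *v y = y"
  shows "cinner x y = 0"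
proof -
  have "cinner x y = cinner (P *v x) (Q *v y)" using assms(3,4) by simp
  also have "\<dots> = cinner x (P *v (Q *v y))" using assms(1) by (simp add: projection_adjoint_cinner)
  also have "\<dots> = 0" using assms(2) by (simp add: matrix_vector_mul_assoc)
  finally show ?thesis .
qed

section \<open>Orthonormal bases and coordinate projections\<close>

lemma orthonormal_basis_cinner:
  "orthonormal_basis v \<Longrightarrow> cinner (v i) (v j) = (if i = j then 1 else 0)"
  by (simp add: orthonormal_basis_def)

lemma orthonormal_basis_nonzero: "orthonormal_basis v \<Longrightarrow> v i \<noteq> 0"
  using orthonormal_basis_cinner[of v i i] by auto

lemma orthonormal_basis_matrix_eqI:
  assumes "orthonormal_basis v" "\<And>j. A *v v j = B *v v j"
  shows "A = B"
proof -
  have "(A - B) *v x = 0" for x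
  proof (rule vec.linear_eq_0_on_span[OF matrix_vector_mul_linear_gen])
    show "x \<in> vec.span (range v)" using assms(1) by (simp add: orthonormal_basis_def)
  qed (use assms(2) in \<open>auto simp: matrix_vector_mult_diff_rdistrib\<close>)
  then show ?thesis by (simp add: matrix_eq matrix_vector_mult_diff_rdistrib)
qed

definition coord_proj :: "('n::finite \<Rightarrow> complex^'n) \<Rightarrow> 'n set \<Rightarrow> 'n cmat" where
  "coord_proj v X = (\<Sum>i\<in>X. outer_prod (v i) (v i))"

lemma coord_proj_empty [simp]: "coord_proj v {} = 0"
  by (simp add: coord_proj_def)

lemma coord_proj_apply:
  assumes "orthonormal_basis v"
  shows "coord_proj v X *v v j = (if j \<in> X then v j else 0)"
proof -
  have "coord_proj v X *v v j = (\<Sum>i\<in>X. if i = j then v i else 0)"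
    unfolding coord_proj_def matrix_vector_mult_sum_left outer_prod_mult_vec
    by (rule sum.cong) (simp_all add: orthonormal_basis_cinner[OF assms])
  then show ?thesis by (simp add: sum.delta')
qed

lemma coord_proj_eqI:
  assumes "orthonormal_basis v" "\<And>j. P *v v j = (if j \<in> X then v j else 0)"
  shows "P = coord_proj v X"
  by (rule orthonormal_basis_matrix_eqI[OF assms(1)]) (simp add: assms coord_proj_apply)

lemma coord_proj_UNIV: "orthonormal_basis v \<Longrightarrow> coord_proj v UNIV = mat 1"
  by (rule coord_proj_eqI[symmetric]) simp_all

lemma coord_proj_Compl: "orthonormal_basis v \<Longrightarrow> mat 1 - coord_proj v X = coord_proj v (- X)"
  by (rule coord_proj_eqI) (simp_all add: matrix_vector_mult_diff_rdistrib coord_proj_apply)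

lemma coord_proj_mult:
  "orthonormal_basis v \<Longrightarrow> coord_proj v X ** coord_proj v Y = coord_proj v (X \<inter> Y)"
  by (rule coord_proj_eqI) (simp_all add: matrix_vector_mul_assoc[symmetric] coord_proj_apply)

lemma is_projection_coord_proj: "orthonormal_basis v \<Longrightarrow> is_projection (coord_proj v X)"
  using coord_proj_mult[of v X X]
  by (simp add: is_projection_def coord_proj_def mat_adj_sum mat_adj_outer_prod)

lemma coord_proj_inject:
  assumes "orthonormal_basis v"
  shows "coord_proj v X = coord_proj v Y \<longleftrightarrow> X = Y"
proof
  assume "coord_proj v X = coord_proj v Y"
  then have "(if j \<in> X then v j else 0) = (if j \<in> Y then v j else 0)" for j
    by (metis assms coord_proj_apply)
  then show "X = Y" using orthonormal_basis_nonzero[OF assms] by (metis subsetI subset_antisym)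
qed simp

lemma orthonormal_basis_matrix_eq_0:
  assumes v: "orthonormal_basis v" and A: "\<And>i j. cinner (v i) (A *v v j) = 0"
  shows "A = 0"
proof (rule orthonormal_basis_matrix_eqI[OF v])
  fix j
  have "A *v v j = coord_proj v UNIV *v (A *v v j)" by (simp add: coord_proj_UNIV[OF v])
  also have "\<dots> = 0"
    by (simp add: coord_proj_def matrix_vector_mult_sum_left outer_prod_mult_vec A)
  finally show "A *v v j = 0 *v v j" by simp
qed

lemma cinner_coord_proj_left:
  "orthonormal_basis v \<Longrightarrow> cinner (v i) (coord_proj v X *v x) = (if i \<in> X then cinner (v i) x else 0)"
  by (simp add: projection_adjoint_cinner is_projection_coord_proj coord_proj_apply)

lemma cinner_coord_proj_compression:
  assumes "orthonormal_basis v"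
  shows "cinner (v i) ((coord_proj v R ** A ** coord_proj v R) *v v j) =
    (if i \<in> R \<and> j \<in> R then cinner (v i) (A *v v j) else 0)"
  using assms by (simp add: matrix_vector_mul_assoc[symmetric] coord_proj_apply cinner_coord_proj_left)

lemma commute_coord_proj_iff:
  assumes v: "orthonormal_basis v"
  shows "M ** coord_proj v Y = coord_proj v Y ** M \<longleftrightarrow>
    (\<forall>i\<in>Y. \<forall>j\<in>-Y. cinner (v i) (M *v v j) = 0 \<and> cinner (v j) (M *v v i) = 0)"
proof -
  have entry: "cinner (v i) ((M ** coord_proj v Y - coord_proj v Y ** M) *v v j) =
      (if j \<in> Y then cinner (v i) (M *v v j) else 0) - (if i \<in> Y then cinner (v i) (M *v v j) else 0)"
    for i j
    by (simp add: matrix_vector_mult_diff_rdistrib cinner_diff_right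
        matrix_vector_mul_assoc[symmetric] coord_proj_apply[OF v] cinner_coord_proj_left[OF v])
  have "M ** coord_proj v Y = coord_proj v Y ** M \<longleftrightarrow>
      M ** coord_proj v Y - coord_proj v Y ** M = 0"
    by simp
  also have "\<dots> \<longleftrightarrow> (\<forall>i j. cinner (v i) ((M ** coord_proj v Y - coord_proj v Y ** M) *v v j) = 0)"
  proof
    assume "\<forall>i j. cinner (v i) ((M ** coord_proj v Y - coord_proj v Y ** M) *v v j) = 0"
    then show "M ** coord_proj v Y - coord_proj v Y ** M = 0"
      by (intro orthonormal_basis_matrix_eq_0[OF v]) blast
  qed simp
  also have "\<dots> \<longleftrightarrow> (\<forall>i\<in>Y. \<forall>j\<in>-Y. cinner (v i) (M *v v j) = 0 \<and> cinner (v j) (M *v v i) = 0)"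
    unfolding entry by (auto split: if_splits)
  finally show ?thesis .
qed

lemma span_rows_coord_proj:
  assumes v: "orthonormal_basis v"
  defines "w k \<equiv> \<chi> i. cnj (v k $ i)"
  shows "vec.span (rows (coord_proj v X)) = vec.span (w ` X)"
proof -
  define P where "P = coord_proj v X"
  have P_entry: "P $ i $ j = (\<Sum>k\<in>X. v k $ i * cnj (v k $ j))" for i j
    by (simp add: P_def coord_proj_def outer_prod_def)
  have row_P: "row i P = (\<Sum>k\<in>X. (v k $ i) *s w k)" for i
    by (simp add: row_def vec_eq_iff P_entry w_def)
  have w_row: "w m = (\<Sum>i\<in>UNIV. cnj (v m $ i) *s row i P)" if "m \<in> X" for m
  proof -
    have "(\<Sum>i\<in>UNIV. cnj (v m $ i) * (\<Sum>k\<in>X. v k $ i * cnj (v k $ j))) =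
          (\<Sum>k\<in>X. cinner (v m) (v k) * cnj (v k $ j))" for j
      by (simp add: cinner_def sum_distrib_left sum_distrib_right mult_ac) (rule sum.swap)
    also have "\<dots> j = cnj (v m $ j)" for j
      using that by (simp add: orthonormal_basis_cinner[OF v] if_distrib if_distribR cong: if_cong)
    finally show ?thesis by (simp add: vec_eq_iff row_def P_entry w_def)
  qed
  have "row i P \<in> vec.span (w ` X)" for i
    unfolding row_P by (intro vec.span_sum vec.span_scale vec.span_base) simp
  then have "rows P \<subseteq> vec.span (w ` X)" unfolding rows_def by blast
  moreover have "w m \<in> vec.span (rows P)" if "m \<in> X" for m
    unfolding w_row[OF that] by (intro vec.span_sum vec.span_scale vec.span_base) (unfold rows_def, blast)
  then have "w ` X \<subseteq> vec.span (rows P)" by auto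
  ultimately show ?thesis unfolding P_def by (simp add: vec.span_eq)
qed

lemma rank_coord_proj:
  assumes v: "orthonormal_basis v"
  shows "rank (coord_proj v X) = card X"
proof -
  define w where "w k = (\<chi> i. cnj (v k $ i))" for k
  have w_cinner: "cinner (w a) (w b) = (if a = b then 1 else 0)" for a b
  proof -
    have "cinner (w a) (w b) = cnj (cinner (v a) (v b))"
      by (simp add: w_def cinner_def mult.commute)
    then show ?thesis by (simp add: orthonormal_basis_cinner[OF v])
  qed
  then have w_inj: "w a = w b \<longleftrightarrow> a = b" for a b
    by (metis one_neq_zero)
  have "vec.dim (rows (coord_proj v X)) = vec.dim (w ` X)"
    using span_rows_coord_proj[OF v, of X, folded w_def] by (metis vec.dim_span)
  then have "rank (coord_proj v X) = vec.dim (w ` X)" by (simp add: row_rank_def_gen)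
  also have "\<dots> = card (w ` X)"
  proof (cases "finite X")
    case True
    have "orthonormal_set (w ` X)" using w_cinner w_inj unfolding orthonormal_set_def by auto
    then show ?thesis using True by (intro vec.dim_eq_card_independent orthonormal_set_independent) auto
  qed simp
  also have "\<dots> = card X" using w_inj by (simp add: card_image inj_on_def)
  finally show ?thesis .
qed

lemma orthonormal_basis_enumeration:
  fixes B :: "(complex^'n::finite) set"
  assumes "finite B" "orthonormal_set B" "vec.span B = UNIV"
  shows "\<exists>v. orthonormal_basis v \<and> range v = B"
proof -
  have "card B = vec.dim (UNIV::(complex^'n) set)"
    by (rule vec.basis_card_eq_dim) (use assms orthonormal_set_independent in auto)
  then have "card (UNIV::'n set) = card B" by (simp only: vec_dim_card)
  then obtain v where v: "bij_betw v (UNIV::'n set) B"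
    using finite_same_card_bij[of "UNIV::'n set" B] assms(1) by auto
  then have "cinner (v i) (v j) = (if i = j then 1 else 0)" for i j
    using assms(2) unfolding orthonormal_set_def bij_betw_def inj_on_def by auto
  moreover have "range v = B" using v by (simp add: bij_betw_def)
  ultimately show ?thesis using assms(3) unfolding orthonormal_basis_def by blast
qed

lemma fixed_space_has_orthonormal_basis:
  "\<exists>B. finite B \<and> orthonormal_set B \<and> B \<subseteq> {x. T *v x = x} \<and> vec.span B = {x. T *v x = x}"
proof -
  have "vec.subspace {x. T *v x = x}"
    unfolding vec.subspace_def by (auto simp: matrix_vector_right_distrib vec.scale)
  then show ?thesis using subspace_has_orthonormal_basis by blast
qed

lemma projection_remainder:
  assumes P: "is_projection P" and Q: "is_projection Q" and PQ: "P ** Q = 0"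
  shows "is_projection (mat 1 - P - Q) \<and> P ** (mat 1 - P - Q) = 0 \<and> Q ** (mat 1 - P - Q) = 0"
proof -
  have QP: "Q ** P = 0" by (rule projection_mult_eq_0_commute[OF P Q PQ])
  have PP: "P ** P = P" and QQ: "Q ** Q = Q" using P Q by (auto simp: is_projection_def)
  have "(mat 1 - P - Q) ** P = 0" "(mat 1 - P - Q) ** Q = 0"
    by (simp_all add: matrix_mul_diff_rdistrib PP QQ PQ QP)
  then show ?thesis
    using P Q PQ QP PP QQ
    by (simp add: is_projection_def mat_adj_diff matrix_mul_diff_ldistrib)
qed

lemma orthonormal_basis_adapted:
  fixes P Q :: "'n::finite cmat"
  assumes P: "is_projection P" and Q: "is_projection Q" and PQ: "P ** Q = 0"
  shows "\<exists>v X Y. orthonormal_basis v \<and> X \<inter> Y = {} \<and> P = coord_proj v X \<and> Q = coord_proj v Y"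
proof -
  define R where "R = mat 1 - P - Q"
  have QP: "Q ** P = 0" by (rule projection_mult_eq_0_commute[OF P Q PQ])
  have R: "is_projection R" and PR: "P ** R = 0" and QR: "Q ** R = 0"
    using projection_remainder[OF P Q PQ] by (simp_all add: R_def)
  obtain BP where BP: "finite BP" "orthonormal_set BP" "BP \<subseteq> {x. P *v x = x}"
      "vec.span BP = {x. P *v x = x}"
    using fixed_space_has_orthonormal_basis by blast
  obtain BQ where BQ: "finite BQ" "orthonormal_set BQ" "BQ \<subseteq> {x. Q *v x = x}"
      "vec.span BQ = {x. Q *v x = x}"
    using fixed_space_has_orthonormal_basis by blast
  obtain BR where BR: "finite BR" "orthonormal_set BR" "BR \<subseteq> {x. R *v x = x}"
      "vec.span BR = {x. R *v x = x}"
    using fixed_space_has_orthonormal_basis by blast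
  have "orthonormal_set (BP \<union> BQ \<union> BR)"
    using BP(3) BQ(3) BR(3)
    by (intro orthonormal_set_Un BP(2) BQ(2) BR(2))
       (auto intro: projection_fixed_vectors_orthogonal[OF P PQ]
         projection_fixed_vectors_orthogonal[OF P PR] projection_fixed_vectors_orthogonal[OF Q QR])
  moreover have "x \<in> vec.span (BP \<union> BQ \<union> BR)" for x
  proof -
    have "P *v x \<in> vec.span BP" "Q *v x \<in> vec.span BQ" "R *v x \<in> vec.span BR"
      using P Q R BP(4) BQ(4) BR(4) by (simp_all add: matrix_vector_mul_assoc is_projection_def)
    then have "P *v x + Q *v x + R *v x \<in> vec.span (BP \<union> BQ \<union> BR)"
      by (meson vec.span_add vec.span_mono sup_ge1 sup_ge2 subsetD)
    then show ?thesis by (simp add: R_def matrix_vector_mult_diff_rdistrib)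
  qed
  ultimately obtain v where v: "orthonormal_basis v" "range v = BP \<union> BQ \<union> BR"
    using orthonormal_basis_enumeration BP(1) BQ(1) BR(1) by (metis finite_UnI UNIV_eq_I)
  have v_cases: "v j \<in> BP \<or> v j \<in> BQ \<or> v j \<in> BR" for j using v(2) by blast
  have annihilates: "T *v x = 0" if "T ** U = 0" "U *v x = x" for T U x
    by (metis that matrix_vector_mul_assoc matrix_vector_mult_0)
  have "P *v v j = (if j \<in> {i. v i \<in> BP} then v j else 0)" for j
    using v_cases[of j] BP(3) BQ(3) BR(3) annihilates[OF PQ] annihilates[OF PR] by auto
  moreover have "Q *v v j = (if j \<in> {i. v i \<in> BQ} then v j else 0)" for j
    using v_cases[of j] BP(3) BQ(3) BR(3) annihilates[OF QP] annihilates[OF QR] by auto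
  ultimately have "P = coord_proj v {i. v i \<in> BP}" "Q = coord_proj v {i. v i \<in> BQ}"
    by (simp_all add: coord_proj_eqI[OF v(1)])
  moreover have "{i. v i \<in> BP} \<inter> {i. v i \<in> BQ} = {}"
    using BP(3) BQ(3) annihilates[OF PQ] orthonormal_basis_nonzero[OF v(1)] by fastforce
  ultimately show ?thesis using v(1) by blast
qed

section \<open>Eigenvectors in invariant subspaces\<close>

definition poly_apply :: "complex poly \<Rightarrow> 'n::finite cmat \<Rightarrow> complex^'n \<Rightarrow> complex^'n" where
  "poly_apply p f x = (\<Sum>i\<le>degree p. coeff p i *s ((*v) f ^^ i) x)"

lemma poly_apply_bound:
  "degree p \<le> N \<Longrightarrow> poly_apply p f x = (\<Sum>i\<le>N. coeff p i *s ((*v) f ^^ i) x)"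
  unfolding poly_apply_def by (rule sum.mono_neutral_left) (auto simp: coeff_eq_0)

lemma poly_apply_add: "poly_apply (p + q) f x = poly_apply p f x + poly_apply q f x"
proof -
  define N where "N = max (degree p) (degree q)"
  have "degree (p + q) \<le> N" "degree p \<le> N" "degree q \<le> N"
    using degree_add_le_max[of p q] by (auto simp: N_def)
  then show ?thesis
    by (simp add: poly_apply_bound[of _ N] sum.distrib vector_sadd_rdistrib)
qed

lemma poly_apply_smult: "poly_apply (smult c p) f x = c *s poly_apply p f x"
proof -
  have "degree (smult c p) \<le> degree p" by (rule degree_smult_le)
  then have "poly_apply (smult c p) f x = (\<Sum>i\<le>degree p. (c * coeff p i) *s ((*v) f ^^ i) x)"
    by (simp add: poly_apply_bound)
  also have "\<dots> = c *s poly_apply p f x"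
    by (simp add: poly_apply_def vec.scale_sum_right vector_smult_assoc)
  finally show ?thesis .
qed

lemma poly_apply_pCons_0: "poly_apply (pCons 0 q) f x = f *v poly_apply q f x"
proof -
  have "poly_apply (pCons 0 q) f x =
      (\<Sum>i\<le>Suc (degree q). coeff (pCons 0 q) i *s ((*v) f ^^ i) x)"
    by (rule poly_apply_bound) (rule degree_pCons_le)
  also have "\<dots> = (\<Sum>i\<le>degree q. coeff q i *s ((*v) f ^^ Suc i) x)"
    by (subst sum.atMost_Suc_shift) simp
  also have "\<dots> = f *v poly_apply q f x"
    by (simp add: poly_apply_def vec.sum vec.scale)
  finally show ?thesis .
qed

lemma poly_apply_linear_factor:
  "poly_apply ([:-l, 1:] * q) f x = f *v poly_apply q f x - l *s poly_apply q f x"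
proof -
  have factor: "[:-l, 1:] * q = smult (-l) q + pCons 0 q" by simp
  show ?thesis unfolding factor poly_apply_add poly_apply_smult poly_apply_pCons_0
    by (simp add: vector_smult_lneg)
qed

lemma poly_apply_in_invariant_subspace:
  assumes "vec.subspace W" "x \<in> W" "\<And>y. y \<in> W \<Longrightarrow> f *v y \<in> W"
  shows "poly_apply p f x \<in> W"
proof -
  have "((*v) f ^^ i) x \<in> W" for i by (induct i) (simp_all add: assms)
  then show ?thesis
    unfolding poly_apply_def using assms(1) by (intro vec.subspace_sum vec.subspace_scale) auto
qed

lemma iterates_linearly_dependent:
  fixes f :: "'n::finite cmat"
  shows "\<exists>c. (\<exists>k\<le>CARD('n). c k \<noteq> 0) \<and> (\<Sum>k\<le>CARD('n). c k *s ((*v) f ^^ k) x) = 0"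
proof (cases "inj_on (\<lambda>k. ((*v) f ^^ k) x) {..CARD('n)}")
  case True
  define K where "K = (\<lambda>k. ((*v) f ^^ k) x) ` {..CARD('n)}"
  have "vec.dependent K"
  proof (rule ccontr)
    assume "vec.independent K"
    then have "card K \<le> vec.dim (UNIV :: (complex^'n) set)"
      using vec.independent_bound_general vec.dim_subset[of K UNIV] by fastforce
    also have "\<dots> = CARD('n)" by (simp only: vec_dim_card)
    finally show False using True by (simp add: K_def card_image)
  qed
  then obtain u where u: "\<exists>y\<in>K. u y \<noteq> 0" "(\<Sum>y\<in>K. u y *s y) = 0"
    using vec.dependent_finite[of K] by (auto simp: K_def)
  have "(\<Sum>y\<in>K. u y *s y) = (\<Sum>k\<le>CARD('n). u (((*v) f ^^ k) x) *s ((*v) f ^^ k) x)"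
    unfolding K_def sum.reindex[OF True] o_def ..
  with u show ?thesis by (intro exI[of _ "\<lambda>k. u (((*v) f ^^ k) x)"]) (auto simp: K_def)
next
  case False
  then obtain i j where ij: "i \<le> CARD('n)" "j \<le> CARD('n)" "i \<noteq> j"
    "((*v) f ^^ i) x = ((*v) f ^^ j) x"
    by (auto simp: inj_on_def)
  define c where "c k = (if k = i then 1 else if k = j then -1 else (0::complex))" for k
  have "(\<Sum>k\<le>CARD('n). c k *s ((*v) f ^^ k) x) = (\<Sum>k\<in>{i, j}. c k *s ((*v) f ^^ k) x)"
    by (rule sum.mono_neutral_right) (use ij in \<open>auto simp: c_def\<close>)
  also have "\<dots> = 0" using ij by (simp add: c_def)
  finally show ?thesis using ij by (intro exI[of _ c]) (auto simp: c_def)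
qed

lemma annihilating_poly_exists: "\<exists>p. p \<noteq> 0 \<and> poly_apply p (f::'n::finite cmat) x = 0"
proof -
  obtain c where c: "\<exists>k\<le>CARD('n). c k \<noteq> 0" "(\<Sum>k\<le>CARD('n). c k *s ((*v) f ^^ k) x) = 0"
    using iterates_linearly_dependent by blast
  define p where "p = (\<Sum>k\<le>CARD('n). monom (c k) k)"
  have coeff_p: "coeff p k = (if k \<le> CARD('n) then c k else 0)" for k
    by (simp add: p_def coeff_sum coeff_monom)
  have "degree p \<le> CARD('n)" by (rule degree_le) (simp add: coeff_p)
  then have "poly_apply p f x = 0" using c(2) by (simp add: poly_apply_bound coeff_p)
  moreover have "p \<noteq> 0" using c(1) coeff_p by (metis coeff_0)
  ultimately show ?thesis by blast
qed

text \<open>Split off linear factors of an annihilating polynomial (fundamental theorem of algebra)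
  until one of them kills a nonzero vector of the subspace.\<close>
lemma invariant_subspace_has_eigenvector:
  fixes f :: "'n::finite cmat"
  assumes W: "vec.subspace W" and inv: "\<And>y. y \<in> W \<Longrightarrow> f *v y \<in> W"
    and x: "x \<in> W" "x \<noteq> 0"
  shows "\<exists>z\<in>W. z \<noteq> 0 \<and> (\<exists>l. f *v z = l *s z)"
proof -
  have "p \<noteq> 0 \<Longrightarrow> poly_apply p f x = 0 \<Longrightarrow> \<exists>z\<in>W. z \<noteq> 0 \<and> (\<exists>l. f *v z = l *s z)" for p
  proof (induct "degree p" arbitrary: p rule: less_induct)
    case less
    show ?case
    proof (cases "degree p = 0")
      case True
      then have "poly_apply p f x = coeff p 0 *s x" by (simp add: poly_apply_def)
      moreover have "coeff p 0 \<noteq> 0" using less(2) True by (metis leading_coeff_0_iff)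
      ultimately show ?thesis using less(3) x(2) by (simp add: vec.scale_eq_0_iff)
    next
      case False
      then have "\<not> constant (poly p)" by (simp add: constant_degree)
      then obtain l where "poly p l = 0" using fundamental_theorem_of_algebra by blast
      then obtain q where q: "p = [:-l, 1:] * q" by (auto simp: poly_eq_0_iff_dvd elim: dvdE)
      have q0: "q \<noteq> 0" using q less(2) by auto
      have "degree ([:-l, 1:] * q) = degree [:-l, 1:] + degree q"
        by (rule degree_mult_eq) (use q0 in simp_all)
      then have "degree q < degree p" using q by simp
      define y where "y = poly_apply q f x"
      have "y \<in> W" unfolding y_def by (rule poly_apply_in_invariant_subspace[OF W x(1) inv])
      moreover have "f *v y = l *s y"
        using less(3) q poly_apply_linear_factor[of l q f x] by (simp add: y_def)
      ultimately show ?thesis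
        using less(1)[OF \<open>degree q < degree p\<close> q0] y_def by blast
    qed
  qed
  with annihilating_poly_exists show ?thesis by blast
qed

section \<open>Irreducible *-algebras of a corner are the whole corner\<close>

lemma projection_commutes_if_invariant:
  assumes E: "is_projection E" and inv: "\<And>b. b \<in> B \<Longrightarrow> E ** b ** E = b ** E"
    and adj: "\<And>b. b \<in> B \<Longrightarrow> mat_adj b \<in> B" and b: "b \<in> B"
  shows "E ** b = b ** E"
proof -
  have E_adj: "mat_adj E = E" using E by (simp add: is_projection_def)
  have "mat_adj (E ** mat_adj b ** E) = mat_adj (mat_adj b ** E)" by (simp add: inv adj b)
  then have "E ** b ** E = E ** b" by (simp add: mat_adj_mult E_adj matrix_mul_assoc)
  with inv[OF b] show ?thesis by simp
qed

lemma dim_image_lt_of_kernel: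
  fixes g :: "'n::finite cmat"
  assumes W: "vec.subspace W" and z: "z \<in> W" "z \<noteq> 0" "g *v z = 0"
  shows "vec.dim ((*v) g ` W) < vec.dim W"
proof -
  have "{z} \<subseteq> W" "vec.independent {z}" using z by auto
  then obtain C where C: "{z} \<subseteq> C" "C \<subseteq> W" "vec.independent C" "W \<subseteq> vec.span C"
    by (rule vec.maximal_independent_subset_extend)
  have fin: "finite C" using C(3) vec.independent_bound_general by blast
  have "(*v) g ` W \<subseteq> (*v) g ` vec.span C" using C(4) by blast
  also have "\<dots> = vec.span ((*v) g ` C)"
    by (rule vec.linear_span_image[OF matrix_vector_mul_linear_gen, symmetric])
  also have "\<dots> \<subseteq> vec.span (insert 0 ((*v) g ` (C - {z})))"
    using z(3) by (intro vec.span_mono) auto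
  also have "\<dots> = vec.span ((*v) g ` (C - {z}))" by (rule vec.span_insert_0)
  finally have "vec.dim ((*v) g ` W) \<le> card ((*v) g ` (C - {z}))"
    by (rule vec.dim_le_card) (use fin in simp)
  also have "\<dots> \<le> card (C - {z})" by (rule card_image_le) (use fin in simp)
  also have "\<dots> < card C" using fin C(1) by (intro card_Diff1_less) auto
  also have "\<dots> = vec.dim W" by (rule vec.basis_card_eq_dim) (use C in auto)
  finally show ?thesis .
qed

lemma subspace_orbit:
  assumes B: "csubspace B"
  shows "vec.subspace {b *v x | b. b \<in> B}"
  unfolding vec.subspace_def
proof (intro conjI ballI allI)
  show "0 \<in> {b *v x |b. b \<in> B}" using csubspace_0[OF B] by force
  fix s t assume "s \<in> {b *v x |b. b \<in> B}" "t \<in> {b *v x |b. b \<in> B}"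
  then obtain b1 b2 where "b1 \<in> B" "b2 \<in> B" "s = b1 *v x" "t = b2 *v x" by blast
  then show "s + t \<in> {b *v x |b. b \<in> B}"
    by (intro CollectI exI[of _ "b1 + b2"])
       (simp add: csubspace_add[OF B] matrix_vector_mult_add_rdistrib)
next
  fix c s assume "s \<in> {b *v x |b. b \<in> B}"
  then obtain b1 where "b1 \<in> B" "s = b1 *v x" by blast
  then show "c *s s \<in> {b *v x |b. b \<in> B}"
    by (intro CollectI exI[of _ "cscale c b1"]) (simp add: csubspace_cscale[OF B] matrix_vector_mult_cscale)
qed

locale irreducible_corner_algebra =
  fixes B :: "'n::finite cmat set" and Q0 :: "'n cmat"
  assumes csubspace: "csubspace B" and unit_mem: "Q0 \<in> B" and subset_corner: "B \<subseteq> corner Q0"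
    and projection: "is_projection Q0"
    and mult_closed: "\<And>X Y. X \<in> B \<Longrightarrow> Y \<in> B \<Longrightarrow> X ** Y \<in> B"
    and adj_closed: "\<And>X. X \<in> B \<Longrightarrow> mat_adj X \<in> B"
    and irreducible: "\<And>Q. is_projection Q \<Longrightarrow> Q ** Q0 = Q \<Longrightarrow> (\<forall>X\<in>B. Q ** X = X ** Q) \<Longrightarrow>
      Q = 0 \<or> Q = Q0"
begin

lemma unit_idem: "Q0 ** Q0 = Q0"
  using projection by (simp add: is_projection_def)

lemma unit_adj: "mat_adj Q0 = Q0"
  using projection by (simp add: is_projection_def)

lemma unit_mult: "X \<in> B \<Longrightarrow> Q0 ** X = X \<and> X ** Q0 = X"
  using subset_corner corner_iff[OF unit_idem] by blast

lemma unit_fixes_range: "X \<in> B \<Longrightarrow> Q0 *v (X *v y) = X *v y"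
  using unit_mult by (simp add: matrix_vector_mul_assoc)

text \<open>The projection onto the invariant subspace \<open>B x\<close> commutes with the *-closed \<open>B\<close>,
  so by irreducibility it is \<open>Q0\<close>.\<close>
lemma transitive:
  assumes x: "x \<noteq> 0" "Q0 *v x = x" and y: "Q0 *v y = y"
  shows "\<exists>b\<in>B. b *v x = y"
proof -
  define V where "V = {b *v x | b. b \<in> B}"
  have "vec.subspace V" unfolding V_def by (rule subspace_orbit[OF csubspace])
  then obtain E where E: "is_projection E" "\<And>t. E *v t \<in> V" "\<And>t. t \<in> V \<Longrightarrow> E *v t = t"
    using projection_onto_subspace_exists by blast
  have V_invariant: "b *v t \<in> V" if "b \<in> B" "t \<in> V" for b t
    using that mult_closed unfolding V_def by (auto simp: matrix_vector_mul_assoc)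
  have "E ** b ** E = b ** E" if "b \<in> B" for b
    unfolding matrix_eq
    by (simp add: matrix_vector_mul_assoc[symmetric] E(3)[OF V_invariant[OF that E(2)]])
  then have commutes: "\<forall>b\<in>B. E ** b = b ** E"
    using projection_commutes_if_invariant[OF E(1)] adj_closed by blast
  have "Q0 *v (E *v t) = E *v t" for t
  proof -
    obtain b where "b \<in> B" "E *v t = b *v x" using E(2)[of t] unfolding V_def by blast
    then show ?thesis by (simp add: unit_fixes_range)
  qed
  then have "Q0 ** E = E" unfolding matrix_eq by (simp add: matrix_vector_mul_assoc[symmetric])
  then have below: "E ** Q0 = E"
    using E(1) by (metis mat_adj_mult is_projection_def unit_adj)
  have "x \<in> V" unfolding V_def using unit_mem x(2) by force
  then have "E \<noteq> 0" using E(3) x(1) by force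
  then have "E = Q0" using irreducible[OF E(1) below commutes] by blast
  then have "y \<in> V" using E(2)[of y] y by simp
  then show ?thesis unfolding V_def by blast
qed

text \<open>An element of minimal rank is compressed by the algebra to multiples of itself:
  otherwise an eigenvalue of \<open>a ** b\<close> on the range of \<open>a\<close> yields a nonzero element
  of smaller rank.\<close>
lemma min_rank_compression:
  assumes a: "a \<in> B" "a \<noteq> 0"
    and min: "\<And>c. c \<in> B \<Longrightarrow> c \<noteq> 0 \<Longrightarrow> vec.dim (range ((*v) a)) \<le> vec.dim (range ((*v) c))"
    and b: "b \<in> B"
  shows "\<exists>l. a ** b ** a = cscale l a"
proof -
  define W where "W = range ((*v) a)"
  have W: "vec.subspace W"
    unfolding W_def by (rule vec.linear_subspace_image[OF matrix_vector_mul_linear_gen vec.subspace_UNIV])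
  obtain x0 where "a *v x0 \<noteq> 0" using a(2) by (metis matrix_eq matrix_vector_mult_0)
  moreover have "(a ** b) *v t \<in> W" if "t \<in> W" for t
    unfolding W_def by (simp add: matrix_vector_mul_assoc[symmetric])
  ultimately obtain z l where z: "z \<in> W" "z \<noteq> 0" "(a ** b) *v z = l *s z"
    using invariant_subspace_has_eigenvector[OF W] unfolding W_def by blast
  define g where "g = a ** b - cscale l Q0"
  have "g *v z = 0"
    using z unit_fixes_range[OF a(1)] unfolding W_def
    by (auto simp: g_def matrix_vector_mult_diff_rdistrib matrix_vector_mult_cscale)
  then have "vec.dim ((*v) g ` W) < vec.dim W" by (rule dim_image_lt_of_kernel[OF W z(1,2)])
  moreover have "range ((*v) (g ** a)) = (*v) g ` W"
    unfolding W_def by (auto simp: matrix_vector_mul_assoc[symmetric] image_iff)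
  moreover have "g ** a = a ** b ** a - cscale l a"
    using unit_mult[OF a(1)] by (simp add: g_def matrix_mul_diff_rdistrib matrix_mul_cscale_left)
  moreover have "a ** b ** a - cscale l a \<in> B"
    by (intro csubspace_diff[OF csubspace] mult_closed csubspace_cscale[OF csubspace] a(1) b)
  ultimately have "a ** b ** a - cscale l a = 0" using min unfolding W_def by fastforce
  then show ?thesis by auto
qed

lemma rank_one_mem:
  assumes "Q0 \<noteq> 0"
  shows "\<exists>u w. u \<noteq> 0 \<and> w \<noteq> 0 \<and> Q0 *v u = u \<and> Q0 *v w = w \<and> outer_prod u w \<in> B"
proof -
  obtain a where a: "a \<in> B" "a \<noteq> 0"
    and min: "\<And>c. c \<in> B \<Longrightarrow> c \<noteq> 0 \<Longrightarrow> vec.dim (range ((*v) a)) \<le> vec.dim (range ((*v) c))"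
    using ex_has_least_nat[of "\<lambda>M. M \<in> B \<and> M \<noteq> 0" Q0 "\<lambda>M. vec.dim (range ((*v) M))"]
      unit_mem assms by blast
  obtain x0 where "a *v x0 \<noteq> 0" using a(2) by (metis matrix_eq matrix_vector_mult_0)
  define u where "u = a *v x0"
  have u: "u \<noteq> 0" "Q0 *v u = u"
    using \<open>a *v x0 \<noteq> 0\<close> unit_fixes_range[OF a(1)] by (auto simp: u_def)
  have a_range: "\<exists>k. a *v y = k *s u" for y
  proof -
    have "Q0 *v (Q0 *v y) = Q0 *v y" by (simp add: matrix_vector_mul_assoc unit_idem)
    then obtain b where b: "b \<in> B" "b *v u = Q0 *v y" using transitive[OF u] by blast
    obtain l where l: "a ** b ** a = cscale l a" using min_rank_compression[OF a min b(1)] by blast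
    have "a *v y = a *v (Q0 *v y)" using unit_mult[OF a(1)] by (simp add: matrix_vector_mul_assoc)
    also have "\<dots> = (a ** b ** a) *v x0"
      by (simp add: b(2)[symmetric] u_def matrix_vector_mul_assoc matrix_mul_assoc)
    also have "\<dots> = l *s u" by (simp add: l matrix_vector_mult_cscale u_def)
    finally show ?thesis by blast
  qed
  define w where "w = mat_adj a *v u"
  have outer_eq: "outer_prod u w = cscale (cinner u u) a"
  proof (rule matrix_eq[THEN iffD2], rule allI)
    fix y
    obtain k where k: "a *v y = k *s u" using a_range by blast
    show "outer_prod u w *v y = cscale (cinner u u) a *v y"
      by (simp add: outer_prod_mult_vec w_def cinner_matrix_vector_mult[symmetric] k
          cinner_scale_right matrix_vector_mult_cscale vector_smult_assoc mult.commute)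
  qed
  then have "outer_prod u w \<in> B" using csubspace_cscale[OF csubspace a(1)] by simp
  moreover have "w \<noteq> 0" using outer_eq a(2) u(1) by (auto simp: cscale_eq_0_iff)
  moreover have "Q0 *v w = w" unfolding w_def by (rule unit_fixes_range[OF adj_closed[OF a(1)]])
  ultimately show ?thesis using u by blast
qed

lemma outer_prod_mem:
  assumes y: "Q0 *v y = y" and z: "Q0 *v z = z"
  shows "outer_prod y z \<in> B"
proof (cases "y = 0 \<or> z = 0")
  case True
  then show ?thesis using csubspace_0[OF csubspace] by auto
next
  case False
  then have "Q0 \<noteq> 0" using y by auto
  then obtain u w where u: "u \<noteq> 0" "Q0 *v u = u" and w: "w \<noteq> 0" "Q0 *v w = w"
    and uw: "outer_prod u w \<in> B"
    using rank_one_mem by blast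
  obtain b1 where b1: "b1 \<in> B" "b1 *v u = y" using transitive[OF u y] by blast
  obtain b2 where b2: "b2 \<in> B" "b2 *v w = z" using transitive[OF w z] by blast
  have "b1 ** outer_prod u w ** mat_adj b2 = outer_prod y z"
    by (simp add: matrix_mul_outer_prod outer_prod_matrix_mul b1(2) b2(2))
  moreover have "b1 ** outer_prod u w ** mat_adj b2 \<in> B"
    by (intro mult_closed adj_closed b1(1) b2(1) uw)
  ultimately show ?thesis by simp
qed

theorem eq_corner: "B = corner Q0"
proof
  show "corner Q0 \<subseteq> B"
  proof
    fix M assume "M \<in> corner Q0"
    then have M: "Q0 ** M = M" "M ** Q0 = M" using corner_iff[OF unit_idem] by auto
    have "M = (\<Sum>j\<in>UNIV. outer_prod (M *v axis j 1) (axis j 1)) ** Q0"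
      using M(2) matrix_eq_sum_outer_prod_columns[of M] by simp
    also have "\<dots> = (\<Sum>j\<in>UNIV. outer_prod (M *v axis j 1) (Q0 *v axis j 1))"
      by (simp add: matrix_mul_sum_right outer_prod_matrix_mul unit_adj)
    also have "\<dots> \<in> B"
      using M(1) by (intro csubspace_sum[OF csubspace] outer_prod_mem)
        (simp_all add: matrix_vector_mul_assoc unit_idem)
    finally show "M \<in> B" .
  qed
qed (rule subset_corner)

end

section \<open>Powers of a quantum graph and connectedness\<close>

lemma subspace_chain_stabilizes:
  fixes f :: "nat \<Rightarrow> 'a::euclidean_space set"
  assumes sub: "\<And>m. m \<ge> 1 \<Longrightarrow> subspace (f m)"
    and mono: "\<And>m. m \<ge> 1 \<Longrightarrow> f m \<subseteq> f (Suc m)"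
  shows "\<exists>M\<ge>1. f M = f (Suc M)"
proof (rule ccontr)
  assume "\<not> ?thesis"
  then have strict: "\<And>m. m \<ge> 1 \<Longrightarrow> f m \<subset> f (Suc m)" using mono by blast
  have "dim (f (Suc m)) \<ge> m" for m
  proof (induct m)
    case (Suc m)
    have "span (f (Suc m)) \<subset> span (f (Suc (Suc m)))"
      using strict[of "Suc m"] sub[of "Suc m"] sub[of "Suc (Suc m)"]
      by (simp add: span_eq_iff[THEN iffD2])
    then have "dim (f (Suc m)) < dim (f (Suc (Suc m)))" by (rule dim_psubset)
    with Suc show ?case by simp
  qed simp
  then have "dim (f (Suc (DIM('a) + 1))) \<ge> DIM('a) + 1" by blast
  moreover have "dim (f (Suc (DIM('a) + 1))) \<le> DIM('a)" by (rule dim_subset_UNIV)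
  ultimately show False by simp
qed

lemma qpow_Suc: "m \<ge> 1 \<Longrightarrow> qpow T (Suc m) = cspan (set_prod (qpow T m) T)"
  by (cases m) auto

lemma qpow_commute:
  assumes T: "\<And>M. M \<in> T \<Longrightarrow> M ** Q = Q ** M" and m: "m \<ge> 1"
  shows "qpow T m \<subseteq> {N. N ** Q = Q ** (N::'n::finite cmat)}"
  using m
proof (induct m rule: nat_induct_at_least)
  case base
  then show ?case using T by auto
next
  case (Suc m)
  have "set_prod (qpow T m) T \<subseteq> {N. N ** Q = Q ** N}"
  proof
    fix Z assume "Z \<in> set_prod (qpow T m) T"
    then obtain W t where Z: "Z = W ** t" "W \<in> qpow T m" "t \<in> T" by (auto simp: set_prod_def)
    then have "W ** Q = Q ** W" "t ** Q = Q ** t" using Suc(2) T by auto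
    then show "Z \<in> {N. N ** Q = Q ** N}" using Z(1) by (simp, metis matrix_mul_assoc)
  qed
  then show ?case unfolding qpow_Suc[OF Suc(1)] by (rule cspan_minimal[OF csubspace_commutant])
qed

locale corner_quantum_graph =
  fixes T :: "'n::finite cmat set" and Q0 :: "'n cmat"
  assumes csubspace: "csubspace T" and adj_closed: "\<And>A. A \<in> T \<Longrightarrow> mat_adj A \<in> T"
    and unit_mem: "Q0 \<in> T" and subset_corner: "T \<subseteq> corner Q0" and projection: "is_projection Q0"
begin

lemma unit_idem: "Q0 ** Q0 = Q0"
  using projection by (simp add: is_projection_def)

lemma unit_adj: "mat_adj Q0 = Q0"
  using projection by (simp add: is_projection_def)

lemma csubspace_qpow: "m \<ge> 1 \<Longrightarrow> csubspace (qpow T m)"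
  by (induct m rule: nat_induct_at_least) (simp_all add: csubspace qpow_Suc csubspace_cspan)

lemma qpow_subset_corner: "m \<ge> 1 \<Longrightarrow> qpow T m \<subseteq> corner Q0"
proof (induct m rule: nat_induct_at_least)
  case (Suc m)
  have "set_prod (qpow T m) T \<subseteq> corner Q0"
    using Suc(2) subset_corner by (auto simp: set_prod_def intro!: corner_mult_closed[OF unit_idem])
  then show ?case unfolding qpow_Suc[OF Suc(1)] by (rule cspan_minimal[OF csubspace_corner])
qed (simp add: subset_corner)

lemma qpow_mono: "m \<ge> 1 \<Longrightarrow> qpow T m \<subseteq> qpow T (Suc m)"
proof
  fix M assume m: "m \<ge> 1" and M: "M \<in> qpow T m"
  then have "M = M ** Q0" using qpow_subset_corner[OF m] corner_iff[OF unit_idem] by auto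
  then have "M \<in> set_prod (qpow T m) T" using M unit_mem unfolding set_prod_def by blast
  then show "M \<in> qpow T (Suc m)" using qpow_Suc[OF m] cspan_superset by blast
qed

lemma subset_qpow: "m \<ge> 1 \<Longrightarrow> T \<subseteq> qpow T m"
  by (induct m rule: nat_induct_at_least) (use qpow_mono in auto)

lemma qpow_mult:
  assumes "a \<ge> 1" "b \<ge> 1" "X \<in> qpow T a" "Y \<in> qpow T b"
  shows "X ** Y \<in> qpow T (a + b)"
  using assms(2,4)
proof (induct b arbitrary: Y rule: nat_induct_at_least)
  case base
  then have "X ** Y \<in> set_prod (qpow T a) T" using assms(3) by (auto simp: set_prod_def)
  then show ?case using qpow_Suc[OF assms(1)] cspan_superset by fastforce
next
  case (Suc b)
  have "set_prod (qpow T b) T \<subseteq> {Y. X ** Y \<in> qpow T (a + Suc b)}"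
  proof
    fix Z assume "Z \<in> set_prod (qpow T b) T"
    then obtain W t where Z: "Z = W ** t" "W \<in> qpow T b" "t \<in> T" by (auto simp: set_prod_def)
    have "(X ** W) ** t \<in> set_prod (qpow T (a + b)) T" using Suc(2) Z by (auto simp: set_prod_def)
    then have "(X ** W) ** t \<in> qpow T (a + Suc b)"
      using qpow_Suc[of "a + b"] assms(1) cspan_superset by fastforce
    then show "Z \<in> {Y. X ** Y \<in> qpow T (a + Suc b)}" using Z by (simp add: matrix_mul_assoc)
  qed
  moreover have "csubspace {Y. X ** Y \<in> qpow T (a + Suc b)}"
    using assms(1) by (intro csubspace_preimage_left_mult csubspace_qpow) simp
  ultimately show ?case using Suc(3) qpow_Suc[OF Suc(1)] cspan_minimal by blast
qed

lemma qpow_adj: "m \<ge> 1 \<Longrightarrow> X \<in> qpow T m \<Longrightarrow> mat_adj X \<in> qpow T m"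
proof (induct m arbitrary: X rule: nat_induct_at_least)
  case base
  then show ?case using adj_closed by simp
next
  case (Suc m)
  have "set_prod (qpow T m) T \<subseteq> {Y. mat_adj Y \<in> qpow T (Suc m)}"
  proof
    fix Z assume "Z \<in> set_prod (qpow T m) T"
    then obtain W t where Z: "Z = W ** t" "W \<in> qpow T m" "t \<in> T" by (auto simp: set_prod_def)
    have "mat_adj t ** mat_adj W \<in> qpow T (1 + m)"
      using Z Suc adj_closed by (intro qpow_mult) auto
    then show "Z \<in> {Y. mat_adj Y \<in> qpow T (Suc m)}" using Z by (simp add: mat_adj_mult)
  qed
  moreover have "csubspace {Y. mat_adj Y \<in> qpow T (Suc m)}"
    by (intro csubspace_preimage_mat_adj csubspace_qpow) simp
  ultimately show ?case using Suc(3) qpow_Suc[OF Suc(1)] cspan_minimal by blast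
qed

text \<open>The powers form an increasing chain of (real) subspaces, so they stabilise.\<close>
lemma qpow_stable_mult_closed:
  "\<exists>M\<ge>1. \<forall>X\<in>qpow T M. \<forall>Y\<in>qpow T M. X ** Y \<in> qpow T M"
proof -
  have "\<exists>M\<ge>1. qpow T M = qpow T (Suc M)"
    by (rule subspace_chain_stabilizes) (auto intro!: csubspace_imp_subspace csubspace_qpow qpow_mono)
  then obtain M where M: "M \<ge> 1" "qpow T M = qpow T (Suc M)" by blast
  have "qpow T (M + j) = qpow T M" for j
  proof (induct j)
    case (Suc j)
    have "qpow T (M + Suc j) = cspan (set_prod (qpow T (M + j)) T)"
      using qpow_Suc[of "M + j"] M(1) by simp
    also have "\<dots> = cspan (set_prod (qpow T M) T)" using Suc by simp
    also have "\<dots> = qpow T M" by (rule trans[OF qpow_Suc[OF M(1), symmetric] M(2)[symmetric]])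
    finally show ?case .
  qed simp
  then show ?thesis using qpow_mult[OF M(1) M(1)] M(1) by (metis mult_2 mult_2_right)
qed

lemma one_dim_imp_multiples_of_unit:
  assumes "one_dim T"
  shows "Q0 \<noteq> 0 \<and> (\<forall>M\<in>T. \<exists>d. M = cscale d Q0)"
proof -
  obtain A0 where A0: "A0 \<noteq> 0" "T = {cscale c A0 | c. True}"
    using assms by (auto simp: one_dim_def)
  obtain c0 where c0: "Q0 = cscale c0 A0" using unit_mem A0(2) by auto
  have "A0 \<in> T" using A0(2) by (auto intro: exI[of _ 1])
  then have "A0 \<in> corner Q0" using subset_corner by blast
  then have Q0: "Q0 \<noteq> 0" using A0(1) by (auto simp: corner_def)
  then have "c0 \<noteq> 0" using c0 by (auto simp: cscale_eq_0_iff)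
  have "\<exists>d. M = cscale d Q0" if M: "M \<in> T" for M
  proof -
    obtain c where "M = cscale c A0" using M A0(2) by auto
    then have "M = cscale (c / c0) Q0" using c0 \<open>c0 \<noteq> 0\<close> by (simp add: cscale_cscale)
    then show ?thesis by blast
  qed
  with Q0 show ?thesis by blast
qed

lemma not_qconnected_imp_reducing_projection:
  assumes disconnected: "\<not> qconnected_in Q0 T"
  shows "\<exists>Q. is_projection Q \<and> Q ** Q0 = Q \<and> Q \<noteq> 0 \<and> Q \<noteq> Q0 \<and> (\<forall>M\<in>T. Q ** M = M ** Q)"
proof (rule ccontr)
  assume no_reducing: "\<not> ?thesis"
  obtain M where M: "M \<ge> 1" "\<forall>X\<in>qpow T M. \<forall>Y\<in>qpow T M. X ** Y \<in> qpow T M"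
    using qpow_stable_mult_closed by blast
  have irreducible: "Q = 0 \<or> Q = Q0"
    if "is_projection Q" "Q ** Q0 = Q" "\<forall>X\<in>qpow T M. Q ** X = X ** Q" for Q
    using no_reducing that subset_qpow[OF M(1)] by blast
  have "irreducible_corner_algebra (qpow T M) Q0"
    using M subset_qpow[OF M(1)] unit_mem irreducible
    by unfold_locales (auto simp: csubspace_qpow qpow_subset_corner qpow_adj projection)
  then have "qpow T M = corner Q0" by (rule irreducible_corner_algebra.eq_corner)
  with M(1) disconnected show False unfolding qconnected_in_def by blast
qed

lemma reducing_projection_imp_not_qconnected:
  assumes Q: "is_projection Q" "Q ** Q0 = Q" "Q \<noteq> 0" "Q \<noteq> Q0"
    and commutes: "\<forall>M\<in>T. Q ** M = M ** Q"
  shows "\<not> qconnected_in Q0 T"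
proof -
  have QQ: "Q ** Q = Q" and Q0Q: "Q0 ** Q = Q"
    using Q(1,2) by (auto simp: is_projection_def) (metis mat_adj_mult unit_adj)
  obtain x0 where "Q *v x0 \<noteq> 0" using Q(3) by (metis matrix_eq matrix_vector_mult_0)
  obtain y0 where "(Q0 - Q) *v y0 \<noteq> 0" using Q(4) by (metis matrix_eq matrix_vector_mult_0 eq_iff_diff_eq_0)
  text \<open>A matrix unit from the range of \<open>Q0 - Q\<close> to the range of \<open>Q\<close> lies in the corner
    but does not commute with \<open>Q\<close>.\<close>
  define N where "N = outer_prod (Q *v x0) ((Q0 - Q) *v y0)"
  have Q_left: "Q ** N = N" and Q_right: "N ** Q = 0"
    using QQ Q(1) Q(2)
    by (simp_all add: N_def matrix_mul_outer_prod outer_prod_matrix_mul matrix_vector_mul_assoc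
        matrix_mul_diff_ldistrib is_projection_def)
  have "N \<in> corner Q0"
    using Q0Q unit_idem unit_adj
    by (simp add: corner_iff N_def matrix_mul_outer_prod outer_prod_matrix_mul
        matrix_vector_mul_assoc matrix_mul_diff_ldistrib)
  moreover have "N \<noteq> 0"
    using \<open>Q *v x0 \<noteq> 0\<close> \<open>(Q0 - Q) *v y0 \<noteq> 0\<close> by (simp add: N_def outer_prod_eq_0_iff)
  ultimately have "N \<notin> qpow T m" if "m \<ge> 1" for m
    using Q_left Q_right qpow_commute[of T Q, OF _ that] commutes by auto
  then show "\<not> qconnected_in Q0 T"
    using \<open>N \<in> corner Q0\<close> unfolding qconnected_in_def by blast
qed

theorem not_qconnected_iff_reducing_projection:
  "\<not> qconnected_in Q0 T \<longleftrightarrow>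
    (\<exists>Q. is_projection Q \<and> Q ** Q0 = Q \<and> Q \<noteq> 0 \<and> Q \<noteq> Q0 \<and> (\<forall>M\<in>T. Q ** M = M ** Q))"
  using not_qconnected_imp_reducing_projection reducing_projection_imp_not_qconnected by blast

end

lemma csubspace_compression:
  assumes S: "csubspace S"
  shows "csubspace (compression P S)"
  unfolding csubspace_def compression_def
proof (intro conjI ballI allI)
  let ?Q = "mat 1 - P"
  show "0 \<in> {?Q ** A ** ?Q |A. A \<in> S}" using csubspace_0[OF S] by force
  fix X Y assume "X \<in> {?Q ** A ** ?Q |A. A \<in> S}" "Y \<in> {?Q ** A ** ?Q |A. A \<in> S}"
  then obtain A B where "A \<in> S" "B \<in> S" "X = ?Q ** A ** ?Q" "Y = ?Q ** B ** ?Q" by blast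
  then show "X + Y \<in> {?Q ** A ** ?Q |A. A \<in> S}"
    by (intro CollectI exI[of _ "A + B"])
       (simp add: csubspace_add[OF S] matrix_add_ldistrib matrix_mul_add_rdistrib)
next
  let ?Q = "mat 1 - P"
  fix c X assume "X \<in> {?Q ** A ** ?Q |A. A \<in> S}"
  then obtain A where "A \<in> S" "X = ?Q ** A ** ?Q" by blast
  then show "cscale c X \<in> {?Q ** A ** ?Q |A. A \<in> S}"
    by (intro CollectI exI[of _ "cscale c A"])
       (simp add: csubspace_cscale[OF S] matrix_mul_cscale_left matrix_mul_cscale_right)
qed

lemma compression_corner_quantum_graph:
  assumes S: "quantum_graph S" and P: "is_projection P"
  shows "corner_quantum_graph (compression P S) (mat 1 - P)"
proof -
  let ?Q = "mat 1 - P"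
  have Q: "is_projection ?Q" by (rule is_projection_complement[OF P])
  then have QQ: "?Q ** ?Q = ?Q" and Q_adj: "mat_adj ?Q = ?Q" by (auto simp: is_projection_def)
  have S_sub: "csubspace S" and S_adj: "\<And>A. A \<in> S \<Longrightarrow> mat_adj A \<in> S" and S_one: "mat 1 \<in> S"
    using S by (auto simp: quantum_graph_def)
  show ?thesis
  proof
    show "csubspace (compression P S)" by (rule csubspace_compression[OF S_sub])
    fix X assume "X \<in> compression P S"
    then obtain A where "A \<in> S" "X = ?Q ** A ** ?Q" by (auto simp: compression_def)
    then show "mat_adj X \<in> compression P S"
      unfolding compression_def using S_adj
      by (intro CollectI exI[of _ "mat_adj A"]) (simp add: mat_adj_mult Q_adj matrix_mul_assoc)
  next
    show "?Q \<in> compression P S" unfolding compression_def using S_one QQ by force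
    show "compression P S \<subseteq> corner ?Q" by (auto simp: compression_def corner_def)
  qed (rule Q)
qed

section \<open>Separators in a basis\<close>

lemma not_graph_connected_on_iff:
  "\<not> graph_connected_on E V \<longleftrightarrow> (\<exists>Y\<subseteq>V. Y \<noteq> {} \<and> Y \<noteq> V \<and> (\<forall>i\<in>Y. \<forall>j\<in>V - Y. \<not> E i j))"
proof
  define R where "R = {(a, b). a \<in> V \<and> b \<in> V \<and> E a b}"
  assume "\<not> graph_connected_on E V"
  then obtain x y where xy: "x \<in> V" "y \<in> V" "(x, y) \<notin> R\<^sup>*"
    unfolding graph_connected_on_def R_def by blast
  define Y where "Y = {z \<in> V. (x, z) \<in> R\<^sup>*}"
  have "\<not> E i j" if "i \<in> Y" "j \<in> V - Y" for i j
  proof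
    assume "E i j"
    then have "(x, j) \<in> R\<^sup>*" using that by (auto simp: Y_def R_def intro: rtrancl_into_rtrancl)
    with that show False by (simp add: Y_def)
  qed
  moreover have "x \<in> Y" "y \<notin> Y" using xy by (auto simp: Y_def)
  ultimately show "\<exists>Y\<subseteq>V. Y \<noteq> {} \<and> Y \<noteq> V \<and> (\<forall>i\<in>Y. \<forall>j\<in>V - Y. \<not> E i j)"
    using xy(2) by (intro exI[of _ Y]) (auto simp: Y_def)
next
  assume "\<exists>Y\<subseteq>V. Y \<noteq> {} \<and> Y \<noteq> V \<and> (\<forall>i\<in>Y. \<forall>j\<in>V - Y. \<not> E i j)"
  then obtain Y y z where Y: "Y \<subseteq> V" "\<forall>i\<in>Y. \<forall>j\<in>V - Y. \<not> E i j" and y: "y \<in> Y"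
    and z: "z \<in> V" "z \<notin> Y" by blast
  have "b \<in> Y" if "(y, b) \<in> {(a, b). a \<in> V \<and> b \<in> V \<and> E a b}\<^sup>*" for b
    using that by (induct rule: rtrancl_induct) (use y Y in auto)
  then show "\<not> graph_connected_on E V"
    unfolding graph_connected_on_def using y Y(1) z by blast
qed

lemma Cv_no_edges_iff:
  assumes S: "quantum_graph S" and YZ: "Y \<inter> Z = {}"
  shows "(\<forall>i\<in>Y. \<forall>j\<in>Z. \<not> Cv v S i j) \<longleftrightarrow>
    (\<forall>A\<in>S. \<forall>i\<in>Y. \<forall>j\<in>Z. cinner (v i) (A *v v j) = 0 \<and> cinner (v j) (A *v v i) = 0)"
proof
  assume no_edge: "\<forall>i\<in>Y. \<forall>j\<in>Z. \<not> Cv v S i j"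
  have zero: "cinner (v i) (A *v v j) = 0" if "A \<in> S" "i \<in> Y" "j \<in> Z" for A i j
  proof -
    have "i \<noteq> j" using that YZ by blast
    then show ?thesis using no_edge that by (auto simp: Cv_def)
  qed
  show "\<forall>A\<in>S. \<forall>i\<in>Y. \<forall>j\<in>Z. cinner (v i) (A *v v j) = 0 \<and> cinner (v j) (A *v v i) = 0"
  proof (intro ballI conjI)
    fix A i j assume A: "A \<in> S" and ij: "i \<in> Y" "j \<in> Z"
    show "cinner (v i) (A *v v j) = 0" using zero[OF A ij] .
    have "mat_adj A \<in> S" using S A by (simp add: quantum_graph_def)
    then have "cinner (v i) (mat_adj A *v v j) = 0" using zero ij by blast
    moreover have "cinner (v j) (A *v v i) = cnj (cinner (A *v v i) (v j))"
      by (rule cinner_commute)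
    moreover have "cinner (A *v v i) (v j) = cinner (v i) (mat_adj A *v v j)"
      by (simp add: cinner_matrix_vector_mult)
    ultimately show "cinner (v j) (A *v v i) = 0" by simp
  qed
next
  assume "\<forall>A\<in>S. \<forall>i\<in>Y. \<forall>j\<in>Z. cinner (v i) (A *v v j) = 0 \<and> cinner (v j) (A *v v i) = 0"
  then show "\<forall>i\<in>Y. \<forall>j\<in>Z. \<not> Cv v S i j" unfolding Cv_def by blast
qed

lemma compression_commutes_coord_proj_iff:
  assumes S: "quantum_graph S" and v: "orthonormal_basis v" and Y: "Y \<subseteq> - X"
  shows "(\<forall>M\<in>compression (coord_proj v X) S. M ** coord_proj v Y = coord_proj v Y ** M) \<longleftrightarrow>
    (\<forall>i\<in>Y. \<forall>j\<in>- X - Y. \<not> Cv v S i j)"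
proof -
  define C where "C A = coord_proj v (- X) ** A ** coord_proj v (- X)" for A
  have "(\<forall>M\<in>compression (coord_proj v X) S. M ** coord_proj v Y = coord_proj v Y ** M) \<longleftrightarrow>
      (\<forall>A\<in>S. C A ** coord_proj v Y = coord_proj v Y ** C A)"
    by (auto simp: compression_def coord_proj_Compl[OF v] C_def)
  also have "\<dots> \<longleftrightarrow> (\<forall>A\<in>S. \<forall>i\<in>Y. \<forall>j\<in>- X - Y.
      cinner (v i) (A *v v j) = 0 \<and> cinner (v j) (A *v v i) = 0)"
    unfolding commute_coord_proj_iff[OF v] C_def cinner_coord_proj_compression[OF v]
    using Y by (auto simp: subset_iff)
  also have "\<dots> \<longleftrightarrow> (\<forall>i\<in>Y. \<forall>j\<in>- X - Y. \<not> Cv v S i j)"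
    by (rule Cv_no_edges_iff[OF S, symmetric]) blast
  finally show ?thesis .
qed

lemma c_separator_imp_q_separator:
  assumes S: "quantum_graph S" and v: "orthonormal_basis v" and sep: "c_separator (Cv v S) X"
  shows "q_separator S (coord_proj v X)"
proof -
  have P: "is_projection (coord_proj v X)" by (rule is_projection_coord_proj[OF v])
  interpret corner_quantum_graph "compression (coord_proj v X) S" "coord_proj v (- X)"
    using compression_corner_quantum_graph[OF S P] by (simp add: coord_proj_Compl[OF v])
  have "one_dim (compression (coord_proj v X) S) \<or>
      \<not> qconnected_in (coord_proj v (- X)) (compression (coord_proj v X) S)"
  proof (cases "card (- X) = 1")
    case True
    then obtain r where r: "- X = {r}" by (rule card_1_singletonE)
    then have Q0: "coord_proj v (- X) = outer_prod (v r) (v r)" by (simp add: coord_proj_def)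
    have "compression (coord_proj v X) S = {cscale c (coord_proj v (- X)) | c. True}"
      using subset_corner unit_mem csubspace_cscale[OF csubspace unit_mem]
      unfolding Q0 corner_rank_one[OF orthonormal_basis_cinner[OF v, of r r, simplified]] by auto
    moreover have "coord_proj v (- X) \<noteq> 0"
      using coord_proj_inject[OF v, of "- X" "{}"] r by simp
    ultimately show ?thesis unfolding one_dim_def by blast
  next
    case False
    then have "\<not> graph_connected_on (Cv v S) (- X)"
      using sep by (simp add: c_separator_def Compl_eq_Diff_UNIV)
    then obtain Y where Y: "Y \<subseteq> - X" "Y \<noteq> {}" "Y \<noteq> - X" "\<forall>i\<in>Y. \<forall>j\<in>- X - Y. \<not> Cv v S i j"
      by (auto simp: not_graph_connected_on_iff)
    have "coord_proj v Y ** coord_proj v (- X) = coord_proj v Y"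
      using Y(1) by (simp add: coord_proj_mult[OF v] Int_absorb2)
    moreover have "\<forall>M\<in>compression (coord_proj v X) S. coord_proj v Y ** M = M ** coord_proj v Y"
      using compression_commutes_coord_proj_iff[OF S v Y(1)] Y(4) by simp
    moreover have "coord_proj v Y \<noteq> 0" "coord_proj v Y \<noteq> coord_proj v (- X)"
      using Y(2,3) coord_proj_inject[OF v, of Y "{}"] coord_proj_inject[OF v, of Y "- X"] by simp_all
    ultimately have "\<not> qconnected_in (coord_proj v (- X)) (compression (coord_proj v X) S)"
      using is_projection_coord_proj[OF v, of Y] not_qconnected_iff_reducing_projection by blast
    then show ?thesis ..
  qed
  then show ?thesis using P by (auto simp: q_separator_def coord_proj_Compl[OF v])
qed

lemma one_dim_compression_imp_c_separator:
  assumes S: "quantum_graph S" and P: "is_projection P" and one_dim: "one_dim (compression P S)"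
  shows "\<exists>v X. orthonormal_basis v \<and> P = coord_proj v X \<and> c_separator (Cv v S) X"
proof -
  interpret corner_quantum_graph "compression P S" "mat 1 - P"
    by (rule compression_corner_quantum_graph[OF S P])
  obtain v X where v: "orthonormal_basis v" and PX: "P = coord_proj v X"
    using orthonormal_basis_adapted[OF P is_projection_0] by auto
  have Q0: "mat 1 - P = coord_proj v (- X)" by (simp add: PX coord_proj_Compl[OF v])
  text \<open>Every element of the compression is a multiple of its unit, so all vertices of
    \<open>-X\<close> are isolated.\<close>
  have "mat 1 - P \<noteq> 0" and multiple: "\<forall>M\<in>compression P S. \<exists>d. M = cscale d (mat 1 - P)"
    using one_dim_imp_multiples_of_unit[OF one_dim] by auto
  have "c_separator (Cv v S) X"
  proof (cases "card (- X) = 1")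
    case False
    have "- X \<noteq> {}" using \<open>mat 1 - P \<noteq> 0\<close> Q0 by auto
    then obtain i where i: "i \<in> - X" by blast
    have "coord_proj v {i} ** coord_proj v (- X) = coord_proj v (- X) ** coord_proj v {i}"
      by (simp add: coord_proj_mult[OF v] Int_commute)
    then have "M ** coord_proj v {i} = coord_proj v {i} ** M" if "M \<in> compression P S" for M
      using multiple that Q0 by (auto simp: matrix_mul_cscale_left matrix_mul_cscale_right)
    then have "\<forall>j\<in>- X - {i}. \<not> Cv v S i j"
      using compression_commutes_coord_proj_iff[OF S v, of "{i}" X] i by (simp add: PX)
    moreover have "{i} \<noteq> - X"
    proof
      assume "{i} = - X"
      then have "card (- X) = 1" by (simp flip: \<open>{i} = - X\<close>)
      with False show False ..
    qed
    ultimately have "\<not> graph_connected_on (Cv v S) (- X)"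
      unfolding not_graph_connected_on_iff using i by blast
    then show ?thesis by (simp add: c_separator_def Compl_eq_Diff_UNIV)
  qed (simp add: c_separator_def Compl_eq_Diff_UNIV)
  then show ?thesis using v PX by blast
qed

lemma disconnected_compression_imp_c_separator:
  assumes S: "quantum_graph S" and P: "is_projection P"
    and disconnected: "\<not> qconnected_in (mat 1 - P) (compression P S)"
  shows "\<exists>v X. orthonormal_basis v \<and> P = coord_proj v X \<and> c_separator (Cv v S) X"
proof -
  interpret corner_quantum_graph "compression P S" "mat 1 - P"
    by (rule compression_corner_quantum_graph[OF S P])
  obtain Q where Q: "is_projection Q" "Q ** (mat 1 - P) = Q" "Q \<noteq> 0" "Q \<noteq> mat 1 - P"
    and commutes: "\<forall>M\<in>compression P S. Q ** M = M ** Q"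
    using disconnected not_qconnected_iff_reducing_projection by blast
  have "Q ** P = 0" using Q(2) by (simp add: matrix_mul_diff_ldistrib)
  then have "P ** Q = 0" by (rule projection_mult_eq_0_commute[OF Q(1) P])
  then obtain v X Y where v: "orthonormal_basis v" and XY: "X \<inter> Y = {}"
    and PX: "P = coord_proj v X" and QY: "Q = coord_proj v Y"
    using orthonormal_basis_adapted[OF P Q(1)] by blast
  have Y: "Y \<subseteq> - X" using XY by blast
  have "Y \<noteq> {}" "Y \<noteq> - X"
    using Q(3,4) by (auto simp: QY PX coord_proj_Compl[OF v])
  moreover have "\<forall>i\<in>Y. \<forall>j\<in>- X - Y. \<not> Cv v S i j"
    using compression_commutes_coord_proj_iff[OF S v Y] commutes by (simp add: PX QY)
  ultimately have "\<not> graph_connected_on (Cv v S) (- X)"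
    unfolding not_graph_connected_on_iff using Y by blast
  then show ?thesis using v PX by (auto simp: c_separator_def Compl_eq_Diff_UNIV)
qed

lemma q_separator_imp_c_separator:
  assumes S: "quantum_graph S" and sep: "q_separator S P"
  shows "\<exists>v X. orthonormal_basis v \<and> P = coord_proj v X \<and> c_separator (Cv v S) X"
  using sep one_dim_compression_imp_c_separator[OF S] disconnected_compression_imp_c_separator[OF S]
  by (auto simp: q_separator_def)

theorem proposition4p5:
  fixes S :: "'n::finite cmat set" and k :: nat
  assumes "quantum_graph S"
  shows "q_k_connected S k \<longleftrightarrow> (\<forall>v. orthonormal_basis v \<longrightarrow> c_k_connected (Cv v S) k)"
proof
  assume "q_k_connected S k"
  then show "\<forall>v. orthonormal_basis v \<longrightarrow> c_k_connected (Cv v S) k"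
    using c_separator_imp_q_separator[OF assms] rank_coord_proj
    unfolding q_k_connected_def c_k_connected_def by metis
next
  assume "\<forall>v. orthonormal_basis v \<longrightarrow> c_k_connected (Cv v S) k"
  then show "q_k_connected S k"
    using q_separator_imp_c_separator[OF assms] rank_coord_proj
    unfolding q_k_connected_def c_k_connected_def by metis
qed

end
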